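(* Let $0 \leq f \in C(X)$ and let $Rf = R^{\varphi,W} f\colon X \to [0,\infty]$ be its extended Dirichlet resolvent. (a) If $Rf(x) < \infty$ for all $x \in X$, then $Rf \in \mathcal F_\varphi$ and $$\varphi^{-1}(\mathcal L Rf) + W\, Rf = f \quad \text{on } X.$$ (b) $Rf(x) < \infty$ for all $x \in X$ if and only if there exists $g \in \mathcal F_\varphi$ with $g \geq 0$ and $$\varphi^{-1}(\mathcal L g) + W g \geq f \quad \text{on } X.$$ In this case, $g \geq Rf$ (for every such $g$).
   Context: Let $X \neq \emptyset$ be a countable set, $C(X)$ the real-valued functions on $X$, $C_c(X)$ those of finite support. Let $m\colon X \to (0,\infty)$ (viewed as a measure on $X$). Let $b$ be a weighted graph over $X$: a symmetric function $b\colon X\times X \to [0,\infty)$ with $b(x,x)=0$ and $\deg(x) := \sum_{y\in X} b(x,y) < \infty$ for all $x \in X$. Inequalities between functions are pointwise. Formal Laplacian: $\mathcal F = \{f \in C(X) : \sum_{y} b(x,y)|f(y)| < \infty \text{ for all } x\in X\}$, and $\mathcal L f(x) = \frac{1}{m(x)}\sum_{y\in X} b(x,y)(f(x)-f(y))$ for $f \in \mathcal F$. Energy: $\mathcal Q(f) = \frac12\sum_{x,y\in X} b(x,y)(f(x)-f(y))^2 \in [0,\infty]$ for $f\in C(X)$, $\mathcal D = \{f : \mathcal Q(f)<\infty\}$, and $\mathcal D_0$ is the set of $f \in \mathcal D$ for which there is a sequence $(f_n)$ in $C_c(X)$ with $f_n \to f$ pointwise and $\mathcal Q(f-f_n)\to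 0$. Standing assumptions: $\varphi\colon\mathbb R\to\mathbb R$ is continuous and strictly increasing with $\varphi(0)=0$; $W\colon X\to(0,\infty)$ with $W_0 := \inf_{x\in X} W(x) > 0$. The inverse $\varphi^{-1}$ is defined on the open interval $\mathrm{ran}\,\varphi$. Let $\mathcal F_\varphi = \{f\in\mathcal F : \mathcal L f(x)\in \mathrm{ran}\,\varphi \text{ for all } x\in X\}$; for $f\in\mathcal F_\varphi$, $\varphi^{-1}(\mathcal L f)+Wf$ denotes the function $x\mapsto \varphi^{-1}(\mathcal L f(x)) + W(x)f(x)$. Dirichlet resolvent: let $\Phi(s)=\int_0^s 2\varphi(t)\,dt$. For $f\in C_c(X)$ let $\kappa_f(u)=\sum_{x\in X}\Phi(f(x)-W(x)u(x))\frac{m(x)}{W(x)} \in [0,\infty]$, $D(\mathcal E_f)=\{u\in\mathcal D_0 : \kappa_f(u)<\infty\}$ and $\mathcal E_f(u)=\mathcal Q(u)+\kappa_f(u)$ for $u\in D(\mathcal E_f)$. The functional $\mathcal E_f$ has a unique minimizer on $D(\mathcal E_f)$, denoted $Rf = R^{\varphi,W}f$ (the Dirichlet resolvent of $f$). Extended Dirichlet resolvent: for $0\le f\in C(X)$, $Rf = R^{\varphi,W}f\colon X\to[0,\infty]$ is $Rf(x)=\sup\{Rg(x) : g\in C_c(X),\ 0\le g\le f\}$ (for $f \in C_c(X)$ this agrees with the Dirichlet resolvent). *)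

theory Defs
  imports "HOL-Analysis.Analysis"
begin

text \<open>The countable nonempty set \<open>X\<close> is the universe of a type of class \<open>countable\<close>.
  Sums over \<open>X\<close> are unconditional sums \<open>infsum\<close>; sums of nonnegative terms that may be
  infinite are taken in \<open>ennreal\<close>, where every family is summable.\<close>

definition weighted_graph :: "('a \<Rightarrow> 'a \<Rightarrow> real) \<Rightarrow> bool" where
  "weighted_graph b \<longleftrightarrow>
     (\<forall>x y. 0 \<le> b x y) \<and> (\<forall>x y. b x y = b y x) \<and> (\<forall>x. b x x = 0) \<and>
     (\<forall>x. (\<lambda>y. b x y) summable_on UNIV)"

definition fin_supp :: "('a \<Rightarrow> real) set" where
  "fin_supp = {f. finite {x. f x \<noteq> 0}}"

definition lap_domain :: "('a \<Rightarrow> 'a \<Rightarrow> real) \<Rightarrow> ('a \<Rightarrow> real) set" where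
  "lap_domain b = {f. \<forall>x. (\<lambda>y. b x y * \<bar>f y\<bar>) summable_on UNIV}"

definition laplacian ::
  "('a \<Rightarrow> real) \<Rightarrow> ('a \<Rightarrow> 'a \<Rightarrow> real) \<Rightarrow> ('a \<Rightarrow> real) \<Rightarrow> 'a \<Rightarrow> real" where
  "laplacian m b f x = 1 / m x * (\<Sum>\<^sub>\<infinity>y. b x y * (f x - f y))"

definition energy :: "('a \<Rightarrow> 'a \<Rightarrow> real) \<Rightarrow> ('a \<Rightarrow> real) \<Rightarrow> ennreal" where
  "energy b f = 1 / 2 * (\<Sum>\<^sub>\<infinity>(x, y). ennreal (b x y * (f x - f y)\<^sup>2))"

definition finite_energy :: "('a \<Rightarrow> 'a \<Rightarrow> real) \<Rightarrow> ('a \<Rightarrow> real) set" where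
  "finite_energy b = {f. energy b f < \<infinity>}"

definition finite_energy0 :: "('a \<Rightarrow> 'a \<Rightarrow> real) \<Rightarrow> ('a \<Rightarrow> real) set" where
  "finite_energy0 b = {f \<in> finite_energy b. \<exists>F :: nat \<Rightarrow> 'a \<Rightarrow> real.
     (\<forall>n. F n \<in> fin_supp) \<and>
     (\<forall>x. (\<lambda>n. F n x) \<longlonglongrightarrow> f x) \<and>
     (\<lambda>n. energy b (\<lambda>x. f x - F n x)) \<longlonglongrightarrow> 0}"

definition lap_domain_phi ::
  "('a \<Rightarrow> real) \<Rightarrow> ('a \<Rightarrow> 'a \<Rightarrow> real) \<Rightarrow> (real \<Rightarrow> real) \<Rightarrow> ('a \<Rightarrow> real) set" where
  "lap_domain_phi m b \<phi> = {f \<in> lap_domain b. \<forall>x. laplacian m b f x \<in> range \<phi>}"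

text \<open>The oriented integral, so the value is nonnegative also for \<open>s < 0\<close>.\<close>

definition Phi :: "(real \<Rightarrow> real) \<Rightarrow> real \<Rightarrow> real" where
  "Phi \<phi> s = (LBINT t=ereal 0..ereal s. 2 * \<phi> t)"

text \<open>All summands of \<open>kappa\<close> are nonnegative, so \<open>ennreal\<close> does not truncate.\<close>

definition kappa ::
  "('a \<Rightarrow> real) \<Rightarrow> (real \<Rightarrow> real) \<Rightarrow> ('a \<Rightarrow> real) \<Rightarrow> ('a \<Rightarrow> real) \<Rightarrow> ('a \<Rightarrow> real) \<Rightarrow> ennreal" where
  "kappa m \<phi> W f u = (\<Sum>\<^sub>\<infinity>x. ennreal (Phi \<phi> (f x - W x * u x) * (m x / W x)))"

definition functional_domain ::
  "('a \<Rightarrow> real) \<Rightarrow> ('a \<Rightarrow> 'a \<Rightarrow> real) \<Rightarrow> (real \<Rightarrow> real) \<Rightarrow> ('a \<Rightarrow> real) \<Rightarrow> ('a \<Rightarrow> real)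
    \<Rightarrow> ('a \<Rightarrow> real) set" where
  "functional_domain m b \<phi> W f = {u \<in> finite_energy0 b. kappa m \<phi> W f u < \<infinity>}"

definition functional ::
  "('a \<Rightarrow> real) \<Rightarrow> ('a \<Rightarrow> 'a \<Rightarrow> real) \<Rightarrow> (real \<Rightarrow> real) \<Rightarrow> ('a \<Rightarrow> real) \<Rightarrow> ('a \<Rightarrow> real)
    \<Rightarrow> ('a \<Rightarrow> real) \<Rightarrow> ennreal" where
  "functional m b \<phi> W f u = energy b u + kappa m \<phi> W f u"

text \<open>Meaningful for \<open>f \<in> fin_supp\<close>, where the minimizer exists and is unique.\<close>

definition resolvent ::
  "('a \<Rightarrow> real) \<Rightarrow> ('a \<Rightarrow> 'a \<Rightarrow> real) \<Rightarrow> (real \<Rightarrow> real) \<Rightarrow> ('a \<Rightarrow> real) \<Rightarrow> ('a \<Rightarrow> real)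
    \<Rightarrow> 'a \<Rightarrow> real" where
  "resolvent m b \<phi> W f =
     (THE u. is_arg_min (functional m b \<phi> W f) (\<lambda>u. u \<in> functional_domain m b \<phi> W f) u)"

definition ext_resolvent ::
  "('a \<Rightarrow> real) \<Rightarrow> ('a \<Rightarrow> 'a \<Rightarrow> real) \<Rightarrow> (real \<Rightarrow> real) \<Rightarrow> ('a \<Rightarrow> real) \<Rightarrow> ('a \<Rightarrow> real)
    \<Rightarrow> 'a \<Rightarrow> ereal" where
  "ext_resolvent m b \<phi> W f x =
     (SUP g \<in> {g \<in> fin_supp. \<forall>y. 0 \<le> g y \<and> g y \<le> f y}. ereal (resolvent m b \<phi> W g x))"

end

theory Submission
  imports Defs
begin

text \<open>
  Everything rests on one comparison principle: if \<open>u\<close> lies in \<open>\<D>\<^sub>0\<close>, \<open>g \<ge> 0\<close>, and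
  \<open>\<L> u < \<L> g\<close> wherever \<open>u > g\<close>, then \<open>u \<le> g\<close>. For finitely supported \<open>F\<^sub>n\<close> approximating \<open>u\<close>
  the functions \<open>(min F\<^sub>n u - g)\<^sup>+\<close> have finite support because \<open>g \<ge> 0\<close>, so they may be used as test
  functions in Green's formula although \<open>g\<close> need not have finite energy.

  A minimizer exists by the direct method, since minimizing sequences are Cauchy in energy by the
  parallelogram identity and pointwise bounded by the growth of \<open>\<Phi>\<close>. Variation at a single
  vertex gives \<open>\<L> u = \<phi> (f - W u)\<close>. Comparison then yields nonnegativity, uniqueness and
  monotonicity of the resolvent, and its domination by every nonnegative supersolution. Part (a)
  follows by monotone convergence along \<open>f 1\<^sub>K\<close> with finite \<open>K\<close> exhausting \<open>X\<close>.
\<close>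

section \<open>Sums and limits\<close>

lemma ennreal_infsum_add:
  fixes f g :: "'i \<Rightarrow> ennreal"
  shows "infsum f A + infsum g A = infsum (\<lambda>x. f x + g x) A"
  by (intro infsum_add[symmetric] nonneg_summable_on_complete) auto

lemma ennreal_infsum_eq_SUP:
  fixes g :: "'i \<Rightarrow> real"
  assumes "\<And>x. 0 \<le> g x"
  shows "(\<Sum>\<^sub>\<infinity>x. ennreal (g x)) = (SUP F\<in>{F. finite F}. ennreal (sum g F))"
  by (simp add: nonneg_infsum_complete sum_ennreal assms)

text \<open>Bridge between the extended-valued sums of the definitions and real unconditional
  summability, where subtraction and interchange of sums are available.\<close>

lemma ennreal_infsum_finite_iff:
  fixes g :: "'i \<Rightarrow> real"
  assumes "\<And>x. 0 \<le> g x"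
  shows "(\<Sum>\<^sub>\<infinity>x. ennreal (g x)) < \<infinity> \<longleftrightarrow> g summable_on UNIV"
proof
  assume "(\<Sum>\<^sub>\<infinity>x. ennreal (g x)) < \<infinity>"
  then obtain c where c: "(\<Sum>\<^sub>\<infinity>x. ennreal (g x)) = ennreal c" "0 \<le> c"
    by (cases "\<Sum>\<^sub>\<infinity>x. ennreal (g x)") auto
  have "sum g F \<le> c" if "finite F" for F
  proof -
    have "ennreal (sum g F) \<le> ennreal c"
      unfolding c(1)[symmetric] ennreal_infsum_eq_SUP[of g, OF assms]
      by (rule SUP_upper) (simp add: that)
    then show ?thesis using c(2) by simp
  qed
  then show "g summable_on UNIV"
    by (intro nonneg_bdd_above_summable_on bdd_aboveI[of _ c]) (auto simp: assms)
next
  assume "g summable_on UNIV"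
  from infsum_nonneg_is_SUPREMUM_ennreal[OF this] assms
  have "(\<Sum>\<^sub>\<infinity>x. ennreal (g x)) = ennreal (infsum g UNIV)"
    by (simp add: ennreal_infsum_eq_SUP)
  then show "(\<Sum>\<^sub>\<infinity>x. ennreal (g x)) < \<infinity>" by simp
qed

lemma ennreal_infsum_summable:
  fixes g :: "'i \<Rightarrow> real"
  assumes "\<And>x. 0 \<le> g x" "g summable_on UNIV"
  shows "(\<Sum>\<^sub>\<infinity>x. ennreal (g x)) = ennreal (infsum g UNIV)"
  using infsum_nonneg_is_SUPREMUM_ennreal[OF assms(2)] assms(1)
  by (simp add: ennreal_infsum_eq_SUP)

text \<open>Only the rows in \<open>S\<close> contribute, so summability of the single rows already
  gives absolute summability over \<open>Sigma S (\<lambda>_. UNIV)\<close>, and the iterated sum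
  follows. Finite support of a test function produces exactly this situation.\<close>

lemma
  fixes h :: "'a \<Rightarrow> 'b \<Rightarrow> real"
  assumes "finite S" "\<And>x y. x \<notin> S \<Longrightarrow> h x y = 0" "\<And>x. h x summable_on UNIV"
  shows summable_on_finite_rows: "(\<lambda>(x, y). h x y) summable_on UNIV"
    and infsum_finite_rows: "(\<Sum>\<^sub>\<infinity>(x, y). h x y) = (\<Sum>x\<in>S. \<Sum>\<^sub>\<infinity>y. h x y)"
proof -
  have "(\<lambda>(x, y). \<bar>h x y\<bar>) summable_on Sigma S (\<lambda>_. UNIV)"
  proof (rule summable_on_SigmaI)
    show "((\<lambda>y. case (x, y) of (x, y) \<Rightarrow> \<bar>h x y\<bar>) has_sum (\<Sum>\<^sub>\<infinity>y. \<bar>h x y\<bar>)) UNIV" for x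
      using assms(3)[of x] summable_on_iff_abs_summable_on_real[of "h x" UNIV] by simp
  qed (use assms(1) in auto)
  then have s: "(\<lambda>(x, y). h x y) summable_on Sigma S (\<lambda>_. UNIV)"
    using summable_on_iff_abs_summable_on_real[of "\<lambda>(x, y). h x y" "Sigma S (\<lambda>_. UNIV)"]
    by (simp add: case_prod_unfold)
  then show "(\<lambda>(x, y). h x y) summable_on UNIV"
    using summable_on_cong_neutral[of UNIV "Sigma S (\<lambda>_. UNIV)" "\<lambda>(x, y). h x y" "\<lambda>(x, y). h x y"] assms(2)
    by auto
  have "(\<Sum>\<^sub>\<infinity>(x, y). h x y) = (\<Sum>\<^sub>\<infinity>(x, y)\<in>Sigma S (\<lambda>_. UNIV). h x y)"
    by (rule infsum_cong_neutral) (use assms(2) in auto)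
  also have "\<dots> = (\<Sum>\<^sub>\<infinity>x\<in>S. \<Sum>\<^sub>\<infinity>y. h x y)"
    using infsum_Sigma_banach[OF s] by simp
  finally show "(\<Sum>\<^sub>\<infinity>(x, y). h x y) = (\<Sum>x\<in>S. \<Sum>\<^sub>\<infinity>y. h x y)"
    using assms(1) by simp
qed

lemma real_summable_on_comparison:
  fixes f g :: "'i \<Rightarrow> real"
  assumes "g summable_on A" "\<And>x. x \<in> A \<Longrightarrow> \<bar>f x\<bar> \<le> g x"
  shows "f summable_on A"
  unfolding summable_on_iff_abs_summable_on_real[of f A]
  by (rule Infinite_Sum.abs_summable_on_comparison_test'[OF assms(1)]) (simp add: assms(2))

lemma ennreal_tendsto_zero_le:
  fixes f g :: "nat \<Rightarrow> ennreal"
  assumes "\<And>n. f n \<le> g n" "g \<longlonglongrightarrow> 0"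
  shows "f \<longlonglongrightarrow> 0"
  by (rule tendsto_sandwich[OF _ _ tendsto_const assms(2)]) (auto simp: assms(1))

lemma half_ennreal: "(1 / 2 :: ennreal) = ennreal (1 / 2)"
  using divide_ennreal[of 1 2] by simp

text \<open>Monotone convergence with monotonicity in n weakened to domination by the limit. Finite
  partial sums of g are limits of partial sums bounded by the full sums, which gives one inequality
  and summability; domination gives the other.\<close>

lemma has_sum_monotone_limit:
  fixes f :: "nat \<Rightarrow> 'i \<Rightarrow> real"
  assumes nonneg: "\<And>n y. 0 \<le> f n y" and le: "\<And>n y. f n y \<le> g y"
    and summable: "\<And>n. f n summable_on UNIV"
    and lim: "\<And>y. (\<lambda>n. f n y) \<longlonglongrightarrow> g y" and sum_lim: "(\<lambda>n. infsum (f n) UNIV) \<longlonglongrightarrow> s"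
  shows "(g has_sum s) UNIV"
proof -
  have g: "0 \<le> g y" for y using nonneg le order_trans by blast
  have "sum g F \<le> s" if "finite F" for F
  proof (rule LIMSEQ_le[OF _ sum_lim])
    show "(\<lambda>n. sum (f n) F) \<longlonglongrightarrow> sum g F" by (intro tendsto_sum lim)
    show "\<exists>N. \<forall>n\<ge>N. sum (f n) F \<le> infsum (f n) UNIV"
      using finite_sum_le_infsum[OF summable that] nonneg by auto
  qed
  then have fin: "\<And>F. finite F \<Longrightarrow> F \<subseteq> UNIV \<Longrightarrow> sum g F \<le> s" by blast
  then have gs: "g summable_on UNIV"
    by (intro nonneg_bdd_above_summable_on bdd_aboveI[of _ s]) (auto simp: g)
  have "infsum g UNIV \<le> s" using gs fin by (rule infsum_le_finite_sums)
  moreover have "s \<le> infsum g UNIV"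
    by (rule LIMSEQ_le_const2[OF sum_lim]) (auto intro!: infsum_mono summable gs le)
  ultimately show ?thesis using gs by (metis antisym has_sum_infsum)
qed

text \<open>Tychonoff makes the product of the balls compact. Over a countable index type the
  product topology is first countable, so compactness yields convergent subsequences and no diagonal
  argument is needed.\<close>

lemma pointwise_bounded_convergent_subseq:
  fixes U :: "nat \<Rightarrow> 'a::countable \<Rightarrow> real"
  assumes "\<And>n x. \<bar>U n x\<bar> \<le> B x"
  obtains r u where "strict_mono (r :: nat \<Rightarrow> nat)" "\<And>x. (\<lambda>n. U (r n) x) \<longlonglongrightarrow> u x"
proof -
  have "compactin (product_topology (\<lambda>_. euclidean) UNIV) (PiE UNIV (\<lambda>x. cball (0::real) (B x)))"
    unfolding compactin_PiE by simp
  then have "seq_compact (PiE UNIV (\<lambda>x. cball (0::real) (B x)))"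
    by (simp add: euclidean_product_topology compact_imp_seq_compact)
  moreover have "\<forall>n. U n \<in> PiE UNIV (\<lambda>x. cball (0::real) (B x))"
    using assms by (simp add: PiE_UNIV_domain)
  ultimately obtain u r where r: "strict_mono r" "(U \<circ> r) \<longlonglongrightarrow> u"
    unfolding seq_compact_def by blast
  have "(\<lambda>n. U (r n) x) \<longlonglongrightarrow> u x" for x
    using continuous_on_tendsto_compose[OF continuous_on_product_coordinates r(2), of x]
    by (simp add: o_def)
  with r(1) show thesis by (rule that)
qed

lemma fin_supp_add: "f \<in> fin_supp \<Longrightarrow> g \<in> fin_supp \<Longrightarrow> (\<lambda>x. f x + g x) \<in> fin_supp"
  unfolding fin_supp_def
  by (auto intro: finite_subset[of _ "{x. f x \<noteq> 0} \<union> {x. g x \<noteq> 0}"])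

lemma fin_supp_scale: "f \<in> fin_supp \<Longrightarrow> (\<lambda>x. c * f x) \<in> fin_supp"
  unfolding fin_supp_def by (auto intro: finite_subset[of _ "{x. f x \<noteq> 0}"])

section \<open>Energy and the formal Laplacian\<close>

locale measured_graph =
  fixes m :: "'a::countable \<Rightarrow> real" and b :: "'a \<Rightarrow> 'a \<Rightarrow> real"
  assumes m_pos: "m x > 0" and weighted: "weighted_graph b"
begin

section \<open>The energy as a quadratic form\<close>

lemma b_nonneg [simp]: "0 \<le> b x y"
  and b_sym: "b x y = b y x"
  and b_summable: "b x summable_on UNIV"
  using weighted by (auto simp: weighted_graph_def)

text \<open>A supremum over finite sums reduces scaling and lower semicontinuity to statements about
  finite sums.\<close>

lemma energy_eq_SUP:
  "energy b f = (SUP F\<in>{F. finite F}. ennreal (1/2 * (\<Sum>(x, y)\<in>F. b x y * (f x - f y)\<^sup>2)))"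
proof -
  have "energy b f = (1/2) * (\<Sum>\<^sub>\<infinity>p. ennreal ((\<lambda>(x, y). b x y * (f x - f y)\<^sup>2) p))"
    by (simp add: energy_def case_prod_unfold)
  also have "\<dots> = (1/2) * (SUP F\<in>{F. finite F}. ennreal (\<Sum>(x, y)\<in>F. b x y * (f x - f y)\<^sup>2))"
    by (subst ennreal_infsum_eq_SUP) auto
  also have "\<dots> = (SUP F\<in>{F. finite F}. (1/2) * ennreal (\<Sum>(x, y)\<in>F. b x y * (f x - f y)\<^sup>2))"
    by (rule SUP_mult_left_ennreal)
  also have "\<dots> = (SUP F\<in>{F. finite F}. ennreal (1/2 * (\<Sum>(x, y)\<in>F. b x y * (f x - f y)\<^sup>2)))"
    unfolding half_ennreal by (intro SUP_cong refl ennreal_mult[symmetric]) (auto intro!: sum_nonneg)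
  finally show ?thesis .
qed

lemma finite_energy_iff:
  "f \<in> finite_energy b \<longleftrightarrow> (\<lambda>(x, y). b x y * (f x - f y)\<^sup>2) summable_on UNIV"
proof -
  have "f \<in> finite_energy b \<longleftrightarrow> (\<Sum>\<^sub>\<infinity>p. ennreal ((\<lambda>(x, y). b x y * (f x - f y)\<^sup>2) p)) < \<infinity>"
  proof -
    have *: "c * S < \<infinity> \<longleftrightarrow> S < \<infinity>" if "c \<noteq> 0" "c < \<infinity>" for c S :: ennreal
      using that by (auto simp: ennreal_mult_less_top)
    show ?thesis
      unfolding finite_energy_def energy_def case_prod_unfold mem_Collect_eq half_ennreal
      by (rule *) (simp, simp only: infinity_ennreal_def ennreal_less_top)
  qed
  also have "\<dots> \<longleftrightarrow> (\<lambda>(x, y). b x y * (f x - f y)\<^sup>2) summable_on UNIV"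
    by (rule ennreal_infsum_finite_iff) auto
  finally show ?thesis .
qed

lemma energy_eq_infsum:
  assumes "f \<in> finite_energy b"
  shows "energy b f = ennreal (1/2 * (\<Sum>\<^sub>\<infinity>(x, y). b x y * (f x - f y)\<^sup>2))"
proof -
  have "(\<Sum>\<^sub>\<infinity>p. ennreal ((\<lambda>(x, y). b x y * (f x - f y)\<^sup>2) p)) =
      ennreal (\<Sum>\<^sub>\<infinity>(x, y). b x y * (f x - f y)\<^sup>2)"
    by (subst ennreal_infsum_summable)
       (use assms finite_energy_iff in auto)
  then have "energy b f = (1/2) * ennreal (\<Sum>\<^sub>\<infinity>(x, y). b x y * (f x - f y)\<^sup>2)"
    by (simp add: energy_def case_prod_unfold)
  also have "\<dots> = ennreal (1/2 * (\<Sum>\<^sub>\<infinity>(x, y). b x y * (f x - f y)\<^sup>2))"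
    unfolding half_ennreal by (intro ennreal_mult[symmetric]) (auto intro!: infsum_nonneg)
  finally show ?thesis .
qed

lemma energy_mono:
  assumes "\<And>x y. (f x - f y)\<^sup>2 \<le> (g x - g y)\<^sup>2"
  shows "energy b f \<le> energy b g"
  unfolding energy_def
  by (intro mult_left_mono infsum_mono nonneg_summable_on_complete)
     (auto intro!: ennreal_leI mult_left_mono assms)

lemma energy_scale: "energy b (\<lambda>x. c * f x) = ennreal (c\<^sup>2) * energy b f"
proof -
  have "1/2 * (\<Sum>(x, y)\<in>F. b x y * (c * f x - c * f y)\<^sup>2) =
      c\<^sup>2 * (1/2 * (\<Sum>(x, y)\<in>F. b x y * (f x - f y)\<^sup>2))" for F
    by (simp add: sum_distrib_left case_prod_unfold power2_eq_square algebra_simps)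
  then have "ennreal (1/2 * (\<Sum>(x, y)\<in>F. b x y * (c * f x - c * f y)\<^sup>2)) =
      ennreal (c\<^sup>2) * ennreal (1/2 * (\<Sum>(x, y)\<in>F. b x y * (f x - f y)\<^sup>2))" for F
    by (simp only:) (intro ennreal_mult, auto intro!: sum_nonneg)
  then show ?thesis
    unfolding energy_eq_SUP by (simp only: SUP_mult_left_ennreal)
qed

text \<open>The identity holds term by term. Stated with sums only, it is valid in
  \<open>ennreal\<close> without assuming that any of the energies is finite.\<close>

lemma energy_parallelogram:
  "energy b (\<lambda>x. f x + g x) + energy b (\<lambda>x. f x - g x) =
   (energy b f + energy b f) + (energy b g + energy b g)"
proof -
  have *: "ennreal (b x y * (f x + g x - (f y + g y))\<^sup>2) + ennreal (b x y * (f x - g x - (f y - g y))\<^sup>2) =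
     (ennreal (b x y * (f x - f y)\<^sup>2) + ennreal (b x y * (f x - f y)\<^sup>2)) +
     (ennreal (b x y * (g x - g y)\<^sup>2) + ennreal (b x y * (g x - g y)\<^sup>2))" for x y
  proof -
    have "b x y * (f x + g x - (f y + g y))\<^sup>2 + b x y * (f x - g x - (f y - g y))\<^sup>2 =
     (b x y * (f x - f y)\<^sup>2 + b x y * (f x - f y)\<^sup>2) +
     (b x y * (g x - g y)\<^sup>2 + b x y * (g x - g y)\<^sup>2)"
      by (simp add: power2_eq_square algebra_simps)
    then show ?thesis
      by (simp del: ennreal_plus add: ennreal_plus[symmetric])
  qed
  show ?thesis
    unfolding energy_def case_prod_unfold
    by (simp only: distrib_left[symmetric] ennreal_infsum_add *)
qed

lemma energy_const [simp]: "energy b (\<lambda>x. c) = 0"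
  by (simp add: energy_def case_prod_unfold)

lemma energy_add_le: "energy b (\<lambda>x. f x + g x) \<le> 2 * energy b f + 2 * energy b g"
  using energy_parallelogram[of f g] by (metis mult_2 le_iff_add)

lemma finite_energy_add:
  "f \<in> finite_energy b \<Longrightarrow> g \<in> finite_energy b \<Longrightarrow> (\<lambda>x. f x + g x) \<in> finite_energy b"
  using energy_add_le[of f g]
  by (auto simp: finite_energy_def ennreal_mult_less_top intro!: le_less_trans[OF energy_add_le])

lemma finite_energy_scale:
  "f \<in> finite_energy b \<Longrightarrow> (\<lambda>x. c * f x) \<in> finite_energy b"
  by (auto simp: finite_energy_def energy_scale ennreal_mult_less_top)

text \<open>The bound (w x - w y)^2 \<le> 2 (w x)^2 + 2 (w y)^2 splits the energy into a family with
  finitely many nonzero rows and its transpose; symmetry of b carries summability from one to the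
  other.\<close>

lemma fin_supp_finite_energy:
  assumes "w \<in> fin_supp"
  shows "w \<in> finite_energy b"
proof -
  have 1: "(\<lambda>(x, y). b x y * (2 * (w x)\<^sup>2)) summable_on UNIV"
    by (rule summable_on_finite_rows[of "{x. w x \<noteq> 0}"])
       (use assms in \<open>auto simp: fin_supp_def intro: summable_on_cmult_left b_summable\<close>)
  then have 2: "(\<lambda>(x, y). b x y * (2 * (w y)\<^sup>2)) summable_on UNIV"
    using summable_on_swap[of "\<lambda>(x, y). b x y * (2 * (w x)\<^sup>2)" UNIV UNIV] by (simp add: b_sym)
  have "(w x - w y)\<^sup>2 \<le> 2 * (w x)\<^sup>2 + 2 * (w y)\<^sup>2" for x y
    using zero_le_power2[of "w x + w y"] by (simp add: power2_eq_square algebra_simps)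
  then have "b x y * (w x - w y)\<^sup>2 \<le> b x y * (2 * (w x)\<^sup>2) + b x y * (2 * (w y)\<^sup>2)" for x y
    by (metis b_nonneg distrib_left mult_left_mono)
  then have "(\<lambda>(x, y). b x y * (w x - w y)\<^sup>2) summable_on UNIV"
    by (intro summable_on_comparison_test[OF summable_on_add[OF 1 2]]) auto
  then show ?thesis by (simp add: finite_energy_iff)
qed

text \<open>Since |t| \<le> 1 + t^2, each row of b |f| is dominated by a multiple of the summable
  row of b plus a row of the energy.\<close>

lemma finite_energy_imp_lap_domain:
  assumes "f \<in> finite_energy b"
  shows "f \<in> lap_domain b"
  unfolding lap_domain_def
proof safe
  fix x
  have "(\<lambda>(x, y). b x y * (f x - f y)\<^sup>2) summable_on UNIV \<times> UNIV"
    using assms by (simp add: finite_energy_iff)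
  from summable_on_SigmaD1[OF this, of x]
  have s: "(\<lambda>y. b x y * (f x - f y)\<^sup>2) summable_on UNIV" by simp
  have "\<bar>f y\<bar> \<le> \<bar>f x\<bar> + 1 + (f x - f y)\<^sup>2" for y
  proof -
    have "\<bar>f x - f y\<bar> \<le> 1 + (f x - f y)\<^sup>2"
      using zero_le_power2[of "\<bar>f x - f y\<bar> - 1"] zero_le_power2[of "f x - f y"] by (simp add: power2_eq_square algebra_simps)
    then show ?thesis by linarith
  qed
  then have "b x y * \<bar>f y\<bar> \<le> b x y * (\<bar>f x\<bar> + 1) + b x y * (f x - f y)\<^sup>2" for y
    by (metis b_nonneg distrib_left mult_left_mono)
  then show "(\<lambda>y. b x y * \<bar>f y\<bar>) summable_on UNIV"
    by (intro summable_on_comparison_test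
        [OF summable_on_add[OF summable_on_cmult_left[OF b_summable[of x], of "\<bar>f x\<bar> + 1"] s]]) auto
qed

text \<open>Fatou's lemma in the form that a supremum of functionals continuous under pointwise
  convergence is lower semicontinuous.\<close>

lemma energy_lower_semicontinuous:
  assumes lim: "\<And>x. (\<lambda>n. U n x) \<longlonglongrightarrow> u x"
    and le: "\<forall>\<^sub>F n in sequentially. energy b (U n) \<le> c"
  shows "energy b u \<le> c"
  unfolding energy_eq_SUP
proof (rule SUP_least)
  fix F :: "('a \<times> 'a) set"
  assume fin: "F \<in> {F. finite F}"
  have "(\<lambda>n. 1/2 * (\<Sum>(x, y)\<in>F. b x y * (U n x - U n y)\<^sup>2)) \<longlonglongrightarrow>
      1/2 * (\<Sum>(x, y)\<in>F. b x y * (u x - u y)\<^sup>2)"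
    unfolding case_prod_unfold by (intro tendsto_intros lim)
  moreover have "\<forall>\<^sub>F n in sequentially. ennreal (1/2 * (\<Sum>(x, y)\<in>F. b x y * (U n x - U n y)\<^sup>2)) \<le> c"
    using le by (rule eventually_mono) (use fin in \<open>simp only: energy_eq_SUP SUP_le_iff\<close>)
  ultimately show "ennreal (1/2 * (\<Sum>(x, y)\<in>F. b x y * (u x - u y)\<^sup>2)) \<le> c"
    by (intro tendsto_upperbound[OF tendsto_ennrealI]) auto
qed

section \<open>The formal Laplacian and Green's formula\<close>

lemma laplacian_row_summable:
  assumes "f \<in> lap_domain b"
  shows "(\<lambda>y. b x y * f y) summable_on UNIV" "(\<lambda>y. b x y * (f x - f y)) summable_on UNIV"
proof -
  show 1: "(\<lambda>y. b x y * f y) summable_on UNIV"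
    by (rule real_summable_on_comparison[of "\<lambda>y. b x y * \<bar>f y\<bar>"])
       (use assms in \<open>auto simp: lap_domain_def abs_mult\<close>)
  show "(\<lambda>y. b x y * (f x - f y)) summable_on UNIV"
    using summable_on_add[OF summable_on_cmult_left[OF b_summable[of x], of "f x"],
        of "\<lambda>y. - (b x y * f y)"] 1
    by (simp add: right_diff_distrib summable_on_uminus)
qed

lemma m_laplacian: "m x * laplacian m b f x = (\<Sum>\<^sub>\<infinity>y. b x y * (f x - f y))"
  using m_pos[of x] by (simp add: laplacian_def)

text \<open>Isolates the sum of b u from the degree term, which later allows monotone convergence to
  act on that sum alone.\<close>

lemma m_laplacian_eq_diff:
  assumes "f \<in> lap_domain b"
  shows "m x * laplacian m b f x = infsum (b x) UNIV * f x - (\<Sum>\<^sub>\<infinity>y. b x y * f y)"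
proof -
  have "m x * laplacian m b f x = (\<Sum>\<^sub>\<infinity>y. b x y * f x - b x y * f y)"
    by (simp add: m_laplacian right_diff_distrib)
  also have "\<dots> = (\<Sum>\<^sub>\<infinity>y. b x y * f x) - (\<Sum>\<^sub>\<infinity>y. b x y * f y)"
    using infsum_add[OF summable_on_cmult_left[OF b_summable[of x], of "f x"],
        of "\<lambda>y. - (b x y * f y)"] laplacian_row_summable(1)[OF assms, of x]
    by (simp add: summable_on_uminus infsum_uminus)
  finally show ?thesis by (simp add: infsum_cmult_left')
qed

lemma lap_domain_diff:
  assumes "f \<in> lap_domain b" "g \<in> lap_domain b"
  shows "(\<lambda>x. f x - g x) \<in> lap_domain b"
  unfolding lap_domain_def
proof safe
  fix x
  show "(\<lambda>y. b x y * \<bar>f y - g y\<bar>) summable_on UNIV"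
  proof (rule real_summable_on_comparison)
    show "(\<lambda>y. b x y * \<bar>f y\<bar> + b x y * \<bar>g y\<bar>) summable_on UNIV"
      using assms by (intro summable_on_add) (auto simp: lap_domain_def)
    have "b x y * \<bar>f y - g y\<bar> \<le> b x y * (\<bar>f y\<bar> + \<bar>g y\<bar>)" for y
      by (intro mult_left_mono) auto
    then show "\<bar>b x y * \<bar>f y - g y\<bar>\<bar> \<le> b x y * \<bar>f y\<bar> + b x y * \<bar>g y\<bar>" for y
      by (simp add: distrib_left)
  qed
qed

lemma laplacian_diff:
  assumes "f \<in> lap_domain b" "g \<in> lap_domain b"
  shows "laplacian m b (\<lambda>x. f x - g x) x = laplacian m b f x - laplacian m b g x"
proof -
  have "(\<Sum>\<^sub>\<infinity>y. b x y * (f y - g y)) = (\<Sum>\<^sub>\<infinity>y. b x y * f y) - (\<Sum>\<^sub>\<infinity>y. b x y * g y)"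
    using infsum_add[OF laplacian_row_summable(1)[OF assms(1), of x],
        of "\<lambda>y. - (b x y * g y)"] laplacian_row_summable(1)[OF assms(2), of x]
    by (simp add: summable_on_uminus infsum_uminus right_diff_distrib)
  then have "m x * laplacian m b (\<lambda>x. f x - g x) x = m x * (laplacian m b f x - laplacian m b g x)"
    unfolding right_diff_distrib[of "m x"]
    by (simp add: m_laplacian_eq_diff lap_domain_diff assms algebra_simps)
  then show ?thesis using m_pos[of x] by simp
qed

text \<open>The integrand is \<open>H x y + H y x\<close>, and \<open>H\<close> has finitely many
  nonzero rows because w has finite support. So h only has to lie in the domain of the Laplacian,
  not to have finite energy.\<close>

lemma
  assumes "h \<in> lap_domain b" "w \<in> fin_supp"
  shows green_summable: "(\<lambda>(x, y). b x y * ((h x - h y) * (w x - w y))) summable_on UNIV"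
    and green: "(\<Sum>\<^sub>\<infinity>(x, y). b x y * ((h x - h y) * (w x - w y))) =
      2 * (\<Sum>x | w x \<noteq> 0. m x * laplacian m b h x * w x)"
proof -
  define H where "H x y = b x y * (h x - h y) * w x" for x y
  have fin: "finite {x. w x \<noteq> 0}" using assms(2) by (simp add: fin_supp_def)
  have s: "H x summable_on UNIV" for x
    unfolding H_def by (intro summable_on_cmult_left laplacian_row_summable assms)
  have 1: "(\<lambda>(x, y). H x y) summable_on UNIV"
    by (rule summable_on_finite_rows[OF fin _ s]) (auto simp: H_def)
  have I1: "(\<Sum>\<^sub>\<infinity>(x, y). H x y) = (\<Sum>x | w x \<noteq> 0. m x * laplacian m b h x * w x)"
    by (subst infsum_finite_rows[OF fin _ s]) (auto simp: H_def[abs_def] m_laplacian infsum_cmult_left')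
  have 2: "(\<lambda>(x, y). H y x) summable_on UNIV"
    using 1 summable_on_swap[of "\<lambda>(x, y). H x y" UNIV UNIV] by simp
  have I2: "(\<Sum>\<^sub>\<infinity>(x, y). H y x) = (\<Sum>\<^sub>\<infinity>(x, y). H x y)"
    by (rule infsum_reindex_bij_witness[where i=prod.swap and j=prod.swap]) auto
  have eq: "(\<lambda>(x, y). b x y * ((h x - h y) * (w x - w y))) =
      (\<lambda>p. (\<lambda>(x, y). H x y) p + (\<lambda>(x, y). H y x) p)"
  proof -
    have "b x y * ((h x - h y) * (w x - w y)) = H x y + H y x" for x y
      unfolding H_def b_sym[of y x] by (simp add: algebra_simps)
    then show ?thesis by (simp add: fun_eq_iff)
  qed
  show "(\<lambda>(x, y). b x y * ((h x - h y) * (w x - w y))) summable_on UNIV"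
    unfolding eq by (rule summable_on_add[OF 1 2])
  show "(\<Sum>\<^sub>\<infinity>(x, y). b x y * ((h x - h y) * (w x - w y))) =
      2 * (\<Sum>x | w x \<noteq> 0. m x * laplacian m b h x * w x)"
    unfolding eq infsum_add[OF 1 2] I2 I1 by simp
qed

section \<open>The space \<D>\<open>\<^sub>0\<close>\<close>

lemma finite_energy0_finite_energy: "u \<in> finite_energy0 b \<Longrightarrow> u \<in> finite_energy b"
  by (simp add: finite_energy0_def)

lemma finite_energy0_lap_domain: "u \<in> finite_energy0 b \<Longrightarrow> u \<in> lap_domain b"
  by (intro finite_energy_imp_lap_domain finite_energy0_finite_energy)

lemma finite_energy0_approx:
  assumes "u \<in> finite_energy0 b"
  obtains F where "\<And>n. F n \<in> fin_supp" "\<And>x. (\<lambda>n. F n x) \<longlonglongrightarrow> u x"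
    "(\<lambda>n. energy b (\<lambda>x. u x - F n x)) \<longlonglongrightarrow> 0"
  using assms unfolding finite_energy0_def by auto

lemma finite_energy0I:
  assumes "u \<in> finite_energy b" "\<And>n. F n \<in> fin_supp" "\<And>x. (\<lambda>n. F n x) \<longlonglongrightarrow> u x"
    "(\<lambda>n. energy b (\<lambda>x. u x - F n x)) \<longlonglongrightarrow> 0"
  shows "u \<in> finite_energy0 b"
  using assms unfolding finite_energy0_def by blast

lemma fin_supp_finite_energy0: "w \<in> fin_supp \<Longrightarrow> w \<in> finite_energy0 b"
  by (rule finite_energy0I[of _ "\<lambda>_. w"]) (auto intro: fin_supp_finite_energy)

lemma finite_energy0_add:
  assumes "u \<in> finite_energy0 b" "v \<in> finite_energy0 b"
  shows "(\<lambda>x. u x + v x) \<in> finite_energy0 b"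
proof -
  obtain F where F: "\<And>n. F n \<in> fin_supp" "\<And>x. (\<lambda>n. F n x) \<longlonglongrightarrow> u x"
    "(\<lambda>n. energy b (\<lambda>x. u x - F n x)) \<longlonglongrightarrow> 0"
    using finite_energy0_approx[OF assms(1)] by blast
  obtain G where G: "\<And>n. G n \<in> fin_supp" "\<And>x. (\<lambda>n. G n x) \<longlonglongrightarrow> v x"
    "(\<lambda>n. energy b (\<lambda>x. v x - G n x)) \<longlonglongrightarrow> 0"
    using finite_energy0_approx[OF assms(2)] by blast
  show ?thesis
  proof (rule finite_energy0I[of _ "\<lambda>n x. F n x + G n x"])
    have "energy b (\<lambda>x. u x + v x - (F n x + G n x)) \<le>
        2 * energy b (\<lambda>x. u x - F n x) + 2 * energy b (\<lambda>x. v x - G n x)" for n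
      using energy_add_le[of "\<lambda>x. u x - F n x" "\<lambda>x. v x - G n x"] by (simp add: algebra_simps)
    moreover have "(\<lambda>n. 2 * energy b (\<lambda>x. u x - F n x) + 2 * energy b (\<lambda>x. v x - G n x)) \<longlonglongrightarrow> 2 * 0 + 2 * 0"
      by (intro tendsto_add ennreal_tendsto_cmult F G) auto
    ultimately show "(\<lambda>n. energy b (\<lambda>x. u x + v x - (F n x + G n x))) \<longlonglongrightarrow> 0"
      unfolding mult_zero_right add_0 ennreal_0 by (rule ennreal_tendsto_zero_le)
  qed (use F G assms in \<open>auto intro: fin_supp_add tendsto_add finite_energy_add finite_energy0_finite_energy\<close>)
qed

lemma finite_energy0_scale:
  assumes "u \<in> finite_energy0 b"
  shows "(\<lambda>x. c * u x) \<in> finite_energy0 b"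
proof -
  obtain F where F: "\<And>n. F n \<in> fin_supp" "\<And>x. (\<lambda>n. F n x) \<longlonglongrightarrow> u x"
    "(\<lambda>n. energy b (\<lambda>x. u x - F n x)) \<longlonglongrightarrow> 0"
    using finite_energy0_approx[OF assms] by blast
  show ?thesis
  proof (rule finite_energy0I[of _ "\<lambda>n x. c * F n x"])
    have "(\<lambda>n. ennreal (c\<^sup>2) * energy b (\<lambda>x. u x - F n x)) \<longlonglongrightarrow> ennreal (c\<^sup>2) * 0"
      by (intro ennreal_tendsto_cmult F) auto
    then show "(\<lambda>n. energy b (\<lambda>x. c * u x - c * F n x)) \<longlonglongrightarrow> 0"
      by (simp flip: right_diff_distrib add: energy_scale)
  qed (use F assms in \<open>auto intro: fin_supp_scale tendsto_mult_left finite_energy_scale finite_energy0_finite_energy\<close>)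
qed

lemma finite_energy_diff:
  "f \<in> finite_energy b \<Longrightarrow> g \<in> finite_energy b \<Longrightarrow> (\<lambda>x. f x - g x) \<in> finite_energy b"
  using finite_energy_add[of f "\<lambda>x. - 1 * g x"] finite_energy_scale[of g "- 1"] by simp

text \<open>Needed so that the limit of a minimizing sequence is again an admissible
  function.\<close>

lemma finite_energy0_closed:
  assumes U: "\<And>n. U n \<in> finite_energy0 b" and lim: "\<And>x. (\<lambda>n. U n x) \<longlonglongrightarrow> u x"
    and energy: "(\<lambda>n. energy b (\<lambda>x. u x - U n x)) \<longlonglongrightarrow> 0"
  shows "u \<in> finite_energy0 b"
proof -
  \<comment> \<open>diagonal choice: the \<open>n\<close>-th approximant is controlled only on the first \<open>n\<close> vertices\<close>
  have "\<exists>v. v \<in> fin_supp \<and> energy b (\<lambda>x. U n x - v x) < ennreal (1 / Suc n) \<and>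
      (\<forall>x. to_nat x \<le> n \<longrightarrow> dist (v x) (U n x) < 1 / Suc n)" for n
  proof -
    obtain F where F: "\<And>k. F k \<in> fin_supp" "\<And>x. (\<lambda>k. F k x) \<longlonglongrightarrow> U n x"
      "(\<lambda>k. energy b (\<lambda>x. U n x - F k x)) \<longlonglongrightarrow> 0"
      using finite_energy0_approx[OF U[of n]] by blast
    have fin: "finite {x::'a. to_nat x \<le> n}"
      using finite_vimageI[of "{..n}" "to_nat :: 'a \<Rightarrow> nat"] by (simp add: vimage_def)
    have "\<forall>\<^sub>F k in sequentially. energy b (\<lambda>x. U n x - F k x) < ennreal (1 / Suc n)"
      by (rule order_tendstoD(2)[OF F(3)]) auto
    moreover have "\<forall>\<^sub>F k in sequentially. \<forall>x\<in>{x. to_nat x \<le> n}. dist (F k x) (U n x) < 1 / Suc n"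
      by (intro eventually_ball_finite fin ballI tendstoD F) auto
    ultimately have "\<forall>\<^sub>F k in sequentially. energy b (\<lambda>x. U n x - F k x) < ennreal (1 / Suc n) \<and>
        (\<forall>x\<in>{x. to_nat x \<le> n}. dist (F k x) (U n x) < 1 / Suc n)"
      by (rule eventually_conj)
    then obtain k where "energy b (\<lambda>x. U n x - F k x) < ennreal (1 / Suc n) \<and>
        (\<forall>x\<in>{x. to_nat x \<le> n}. dist (F k x) (U n x) < 1 / Suc n)"
      using eventually_happens by fastforce
    then show ?thesis using F(1)[of k] by auto
  qed
  then obtain V where V: "\<And>n. V n \<in> fin_supp" "\<And>n. energy b (\<lambda>x. U n x - V n x) < ennreal (1 / Suc n)"
      "\<And>n x. to_nat x \<le> n \<Longrightarrow> dist (V n x) (U n x) < 1 / Suc n"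
    by metis
  show ?thesis
  proof (rule finite_energy0I[of _ V])
    have "\<forall>\<^sub>F n in sequentially. energy b (\<lambda>x. u x - U n x) < \<infinity>"
      by (rule order_tendstoD(2)[OF energy]) auto
    then obtain n where "(\<lambda>x. u x - U n x) \<in> finite_energy b"
      using eventually_happens by (force simp: finite_energy_def)
    from finite_energy_add[OF this finite_energy0_finite_energy[OF U[of n]]]
    show "u \<in> finite_energy b" by simp
    have "(\<lambda>n. dist (V n x) (U n x)) \<longlonglongrightarrow> 0" for x
    proof (rule tendsto_sandwich[OF _ _ tendsto_const])
      show "(\<lambda>n. 1 / real (Suc n)) \<longlonglongrightarrow> 0" by (rule LIMSEQ_Suc[OF lim_1_over_n])
      show "\<forall>\<^sub>F n in sequentially. dist (V n x) (U n x) \<le> 1 / real (Suc n)"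
        using V(3)[of x] by (intro eventually_sequentiallyI[of "to_nat x"]) (auto intro: less_imp_le)
    qed auto
    then show "(\<lambda>n. V n x) \<longlonglongrightarrow> u x" for x
      using Lim_transform[OF lim[of x], of "\<lambda>n. V n x"]
      by (simp add: tendsto_rabs_zero_iff dist_real_def)
    have "energy b (\<lambda>x. u x - V n x) \<le> 2 * energy b (\<lambda>x. u x - U n x) + 2 * ennreal (1 / Suc n)" for n
    proof -
      have "energy b (\<lambda>x. u x - V n x) \<le> 2 * energy b (\<lambda>x. u x - U n x) + 2 * energy b (\<lambda>x. U n x - V n x)"
        using energy_add_le[of "\<lambda>x. u x - U n x" "\<lambda>x. U n x - V n x"] by simp
      also have "\<dots> \<le> 2 * energy b (\<lambda>x. u x - U n x) + 2 * ennreal (1 / Suc n)"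
        using V(2)[of n] by (intro add_left_mono mult_left_mono) auto
      finally show ?thesis .
    qed
    moreover have "(\<lambda>n. 2 * energy b (\<lambda>x. u x - U n x) + 2 * ennreal (1 / Suc n)) \<longlonglongrightarrow> 2 * 0 + 2 * ennreal 0"
      by (intro tendsto_add ennreal_tendsto_cmult energy tendsto_ennrealI LIMSEQ_Suc[OF lim_1_over_n]) auto
    ultimately show "(\<lambda>n. energy b (\<lambda>x. u x - V n x)) \<longlonglongrightarrow> 0"
      unfolding mult_zero_right add_0 ennreal_0 by (rule ennreal_tendsto_zero_le)
  qed (rule V)
qed

section \<open>The comparison principle\<close>

lemma comparison_principle:
  assumes u: "u \<in> finite_energy0 b" and g: "g \<in> lap_domain b" "\<And>x. 0 \<le> g x"
    and less: "\<And>x. g x < u x \<Longrightarrow> laplacian m b u x < laplacian m b g x"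
  shows "u x \<le> g x"
proof (rule ccontr)
  assume "\<not> u x \<le> g x"
  then have x: "g x < u x" by simp
  obtain F where F: "\<And>n. F n \<in> fin_supp" "\<And>x. (\<lambda>n. F n x) \<longlonglongrightarrow> u x"
    "(\<lambda>n. energy b (\<lambda>x. u x - F n x)) \<longlonglongrightarrow> 0"
    using finite_energy0_approx[OF u] by blast
  \<comment> \<open>The cutoff at u ensures g < u wherever \<open>w n\<close> is positive, so
    \<open>less\<close> applies on the whole support of \<open>w n\<close>. As g \<ge> 0, that
    support lies inside the finite support of \<open>F n\<close>.\<close>
  define v where "v n y = min (F n y) (u y)" for n y
  define w where "w n y = max 0 (v n y - g y)" for n y
  define h where "h y = u y - g y" for y
  define q where "q n = (\<Sum>\<^sub>\<infinity>(x, y). b x y * (u x - v n x - (u y - v n y))\<^sup>2)" for n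
  have w: "w n \<in> fin_supp" for n
  proof -
    have "w n y = 0" if "F n y = 0" for y
      using g(2)[of y] that by (auto simp: w_def v_def max_def min_def)
    then have "{y. w n y \<noteq> 0} \<subseteq> {y. F n y \<noteq> 0}" by blast
    then show ?thesis using F(1)[of n] by (auto simp: fin_supp_def intro: finite_subset)
  qed
  have h: "h \<in> lap_domain b"
    unfolding h_def by (intro lap_domain_diff finite_energy0_lap_domain u g)
  \<comment> \<open>u - \<open>v n\<close> is the positive part of u - \<open>F n\<close>, and
    passing to positive parts does not increase differences.\<close>
  have contraction: "energy b (\<lambda>x. u x - v n x) \<le> energy b (\<lambda>x. u x - F n x)" for n
  proof (rule energy_mono, rule abs_le_square_iff[THEN iffD1])
    show "\<bar>u x - v n x - (u y - v n y)\<bar> \<le> \<bar>u x - F n x - (u y - F n y)\<bar>" for x y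
      by (auto simp: v_def min_def)
  qed
  have fe: "(\<lambda>x. u x - v n x) \<in> finite_energy b" for n
  proof -
    have "(\<lambda>x. u x - F n x) \<in> finite_energy b"
      by (intro finite_energy_diff fin_supp_finite_energy F finite_energy0_finite_energy u)
    then show ?thesis using contraction[of n] by (auto simp: finite_energy_def)
  qed
  have "(\<lambda>n. energy b (\<lambda>x. u x - v n x)) \<longlonglongrightarrow> 0"
    by (rule ennreal_tendsto_zero_le[OF contraction F(3)])
  then have "(\<lambda>n. ennreal (1/2 * q n)) \<longlonglongrightarrow> ennreal 0"
    using energy_eq_infsum[OF fe] unfolding q_def by simp
  then have "(\<lambda>n. 1/2 * q n) \<longlonglongrightarrow> 0"
    by (subst (asm) tendsto_ennreal_iff) (auto simp: q_def intro!: infsum_nonneg always_eventually)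
  then have "(\<lambda>n. - 1/4 * (1/2 * q n)) \<longlonglongrightarrow> - 1/4 * 0"
    by (intro tendsto_mult tendsto_const)
  \<comment> \<open>The factor 1/8 is the 1/4 obtained by completing the square below, divided by
    the 2 in Green's formula.\<close>
  then have lim0: "(\<lambda>n. - 1/8 * q n) \<longlonglongrightarrow> 0" by simp
  have "(\<lambda>n. m x * laplacian m b h x * w n x) \<longlonglongrightarrow> m x * laplacian m b h x * max 0 (min (u x) (u x) - g x)"
    unfolding w_def v_def by (intro tendsto_intros F)
  then have lim1: "(\<lambda>n. m x * laplacian m b h x * w n x) \<longlonglongrightarrow> m x * laplacian m b h x * (u x - g x)"
    using x by simp
  have lh: "laplacian m b h y < 0" if "w n y \<noteq> 0" for n y
    using less[of y] that unfolding h_def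
    by (subst laplacian_diff[OF finite_energy0_lap_domain[OF u] g(1)])
       (auto simp: w_def v_def max_def min_def split: if_splits)
  have "- 1/8 * q n \<le> m x * laplacian m b h x * w n x" for n
  proof -
    have s: "(\<lambda>(x, y). b x y * (u x - v n x - (u y - v n y))\<^sup>2) summable_on UNIV"
      using fe[of n] by (simp add: finite_energy_iff)
    have point: "- 1/4 * (u x - v n x - (u y - v n y))\<^sup>2 \<le> (h x - h y) * (w n x - w n y)" for x y
    proof -
      let ?p = "u x - v n x - (u y - v n y)" and ?r = "w n x - w n y"
      \<comment> \<open>Write h = (u - \<open>v n\<close>) + (\<open>v n\<close> - g). The first
        summand is small in energy; for the second, an increment times the increment of its positive
        part dominates the square of the latter.\<close>
      have "(v n x - g x - (v n y - g y)) * ?r \<ge> ?r * ?r"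
      proof -
        have *: "(a - a') * (max 0 a - max 0 a') \<ge> (max 0 a - max 0 a') * (max 0 a - max 0 a')"
          for a a' :: real
          by (cases "0 \<le> a"; cases "0 \<le> a'")
             (simp_all add: max_def algebra_simps mult_nonneg_nonpos mult_nonpos_nonneg)
        show ?thesis unfolding w_def by (rule *)
      qed
      moreover have "(h x - h y) * ?r = ?p * ?r + (v n x - g x - (v n y - g y)) * ?r"
        by (simp add: h_def algebra_simps)
      \<comment> \<open>completing the square replaces Cauchy--Schwarz, so no bilinear form is needed\<close>
      moreover have "0 \<le> 1/4 * p\<^sup>2 + p * r + r * r" for p r :: real
        using zero_le_power2[of "p / 2 + r"] by (simp add: power2_eq_square algebra_simps)
      then have "0 \<le> 1/4 * ?p\<^sup>2 + ?p * ?r + ?r * ?r" .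
      ultimately show ?thesis by linarith
    qed
    have "- 1/4 * q n = (\<Sum>\<^sub>\<infinity>p. - 1/4 * (\<lambda>(x, y). b x y * (u x - v n x - (u y - v n y))\<^sup>2) p)"
      unfolding q_def by (rule infsum_cmult_right'[symmetric])
    also have "\<dots> \<le> (\<Sum>\<^sub>\<infinity>(x, y). b x y * ((h x - h y) * (w n x - w n y)))"
    proof (rule infsum_mono)
      show "(\<lambda>p. - 1/4 * (\<lambda>(x, y). b x y * (u x - v n x - (u y - v n y))\<^sup>2) p) summable_on UNIV"
        by (rule summable_on_cmult_right[OF s])
      show "(\<lambda>(x, y). b x y * ((h x - h y) * (w n x - w n y))) summable_on UNIV"
        by (rule green_summable[OF h w])
      show "- 1/4 * (\<lambda>(x, y). b x y * (u x - v n x - (u y - v n y))\<^sup>2) p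
          \<le> (\<lambda>(x, y). b x y * ((h x - h y) * (w n x - w n y))) p" for p
        using mult_left_mono[OF point b_nonneg] by (cases p) (simp add: mult.left_commute)
    qed
    also have "\<dots> = 2 * (\<Sum>y | w n y \<noteq> 0. m y * laplacian m b h y * w n y)"
      by (rule green[OF h w])
    \<comment> \<open>All summands are nonpositive, so keeping only the one at x can only increase
      the sum. Inserting x into the support covers the case \<open>w n x = 0\<close>. In the limit
      the kept term is strictly negative while the energy error vanishes.\<close>
    also have "(\<Sum>y | w n y \<noteq> 0. m y * laplacian m b h y * w n y) \<le> m x * laplacian m b h x * w n x"
    proof -
      have nonpos: "m y * laplacian m b h y * w n y \<le> 0" for y
      proof (cases "w n y = 0")
        case False
        have "0 \<le> w n y" by (simp add: w_def)
        then show ?thesis using lh[OF False] m_pos[of y]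
          by (intro mult_nonpos_nonneg mult_nonneg_nonpos) auto
      qed simp
      have fin: "finite {y. w n y \<noteq> 0}" using w[of n] by (simp add: fin_supp_def)
      have "(\<Sum>y | w n y \<noteq> 0. m y * laplacian m b h y * w n y) =
          (\<Sum>y\<in>insert x {y. w n y \<noteq> 0}. m y * laplacian m b h y * w n y)"
        by (rule sum.mono_neutral_left) (use fin in auto)
      also have "\<dots> = m x * laplacian m b h x * w n x +
          (\<Sum>y\<in>{y. w n y \<noteq> 0} - {x}. m y * laplacian m b h y * w n y)"
        by (rule sum.insert_remove[OF fin])
      finally show ?thesis using sum_nonpos[OF nonpos] by simp
    qed
    finally show ?thesis by simp
  qed
  then have "0 \<le> m x * laplacian m b h x * (u x - g x)"
    by (intro LIMSEQ_le[OF lim0 lim1]) auto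
  moreover have "laplacian m b h x < 0"
    unfolding h_def using less[OF x] by (simp add: laplacian_diff finite_energy0_lap_domain u g)
  ultimately show False
    using x m_pos[of x] by (simp add: zero_le_mult_iff mult_less_0_iff)
qed

end

section \<open>The nonlinear penalty and its minimizers\<close>

lemma Phi_0 [simp]: "Phi \<phi> 0 = 0"
  by (simp add: Phi_def flip: zero_ereal_def)

lemma Phi_has_real_derivative:
  assumes "continuous_on UNIV \<phi>"
  shows "(Phi \<phi> has_real_derivative 2 * \<phi> s) (at s)"
proof -
  let ?A = "{- \<bar>s\<bar> - 1..\<bar>s\<bar> + 1}"
  have "((\<lambda>u. LBINT t=ereal 0..ereal u. 2 * \<phi> t) has_vector_derivative 2 * \<phi> s) (at s within ?A)"
    by (rule interval_integral_FTC2)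
       (auto intro!: continuous_on_mult continuous_on_const continuous_on_subset[OF assms])
  then have "(Phi \<phi> has_vector_derivative 2 * \<phi> s) (at s within ?A)"
    unfolding Phi_def[abs_def] by simp
  moreover have "at s within ?A = at s"
    by (rule at_within_Icc_at) auto
  ultimately show ?thesis
    by (simp add: has_real_derivative_iff_has_vector_derivative)
qed

locale resolvent_problem = measured_graph m b for m :: "'a::countable \<Rightarrow> real" and b +
  fixes \<phi> :: "real \<Rightarrow> real" and W :: "'a \<Rightarrow> real"
  assumes phi_continuous: "continuous_on UNIV \<phi>" and phi_mono: "strict_mono \<phi>"
    and phi_0: "\<phi> 0 = 0" and W_pos: "W x > 0"
begin

lemma phi_less_iff: "\<phi> s < \<phi> t \<longleftrightarrow> s < t" and phi_le_iff: "\<phi> s \<le> \<phi> t \<longleftrightarrow> s \<le> t"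
  using phi_mono by (simp_all add: strict_mono_less strict_mono_less_eq)

lemma inv_phi: "inv \<phi> (\<phi> t) = t"
  using strict_mono_imp_inj_on[OF phi_mono] by (rule inv_f_f)

text \<open>Convexity of \<Phi>, from the mean value theorem and the monotone derivative 2 \<phi>.
  Tangents at 0, at a midpoint and at 1 and -1 give nonnegativity, midpoint convexity and coercivity
  in turn.\<close>

lemma Phi_tangent: "Phi \<phi> s + 2 * \<phi> s * (t - s) \<le> Phi \<phi> t"
proof (cases s t rule: linorder_cases)
  case less
  obtain z where z: "s < z" "z < t" "Phi \<phi> t - Phi \<phi> s = (t - s) * (2 * \<phi> z)"
    using MVT2[OF less, of "Phi \<phi>" "\<lambda>s. 2 * \<phi> s"] Phi_has_real_derivative[OF phi_continuous] by blast
  have "(t - s) * (2 * \<phi> s) \<le> (t - s) * (2 * \<phi> z)"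
    using z less by (intro mult_left_mono) (auto simp: phi_le_iff)
  then show ?thesis using z(3) by (simp add: algebra_simps)
next
  case greater
  obtain z where z: "t < z" "z < s" "Phi \<phi> s - Phi \<phi> t = (s - t) * (2 * \<phi> z)"
    using MVT2[OF greater, of "Phi \<phi>" "\<lambda>s. 2 * \<phi> s"] Phi_has_real_derivative[OF phi_continuous] by blast
  have "(s - t) * (2 * \<phi> z) \<le> (s - t) * (2 * \<phi> s)"
    using z greater by (intro mult_left_mono) (auto simp: phi_le_iff)
  then show ?thesis using z(3) by (simp add: algebra_simps)
qed simp

lemma Phi_nonneg [simp]: "0 \<le> Phi \<phi> t"
  using Phi_tangent[of 0 t] by (simp add: phi_0)

lemma Phi_midpoint: "Phi \<phi> ((s + t) / 2) + Phi \<phi> ((s + t) / 2) \<le> Phi \<phi> s + Phi \<phi> t"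
proof -
  have "2 * \<phi> ((s + t) / 2) * (s - (s + t) / 2) + 2 * \<phi> ((s + t) / 2) * (t - (s + t) / 2) = 0"
    by (simp flip: distrib_left)
  then show ?thesis
    using Phi_tangent[of "(s + t) / 2" s] Phi_tangent[of "(s + t) / 2" t] by linarith
qed

text \<open>The tangents at 1 and -1 have slopes of opposite sign because \<phi>(-1) < 0 <
  \<phi>(1), so together they confine t from both sides. Adding the two bounds gives one expression
  for |t|.\<close>

lemma Phi_sublevel_bounded:
  assumes "Phi \<phi> t \<le> c"
  shows "\<bar>t\<bar> \<le> 1 + c / (2 * \<phi> 1) + c / (- 2 * \<phi> (- 1))"
proof -
  have pos: "0 < \<phi> 1" "0 < - \<phi> (- 1)" "0 \<le> c"
    using phi_less_iff[of 0 1] phi_less_iff[of "- 1" 0] assms order_trans[OF Phi_nonneg assms] by (auto simp: phi_0)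
  have "2 * \<phi> 1 * (t - 1) \<le> c"
    using Phi_tangent[of 1 t] assms Phi_nonneg[of 1] by linarith
  moreover have "2 * \<phi> (- 1) * (t - - 1) \<le> c"
    using Phi_tangent[of "- 1" t] assms Phi_nonneg[of "- 1"] by linarith
  then have "(- 2 * \<phi> (- 1)) * (- t - 1) \<le> c" by (simp add: algebra_simps)
  ultimately have "t - 1 \<le> c / (2 * \<phi> 1)" "- t - 1 \<le> c / (- 2 * \<phi> (- 1))"
    using pos by (simp_all only: pos_le_divide_eq mult.commute[of "_ - 1"])
  moreover have "0 \<le> c / (2 * \<phi> 1)" "0 \<le> c / (- 2 * \<phi> (- 1))"
    using pos by (simp_all add: divide_nonneg_neg)
  ultimately show ?thesis by linarith
qed

definition penalty :: "('a \<Rightarrow> real) \<Rightarrow> ('a \<Rightarrow> real) \<Rightarrow> 'a \<Rightarrow> real" where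
  "penalty f u x = Phi \<phi> (f x - W x * u x) * (m x / W x)"

lemma penalty_nonneg [simp]: "0 \<le> penalty f u x"
  using m_pos[of x] W_pos[of x] by (simp add: penalty_def)

lemma kappa_eq: "kappa m \<phi> W f u = (\<Sum>\<^sub>\<infinity>x. ennreal (penalty f u x))"
  by (simp add: kappa_def penalty_def)

lemma kappa_eq_SUP: "kappa m \<phi> W f u = (SUP G\<in>{G. finite G}. ennreal (sum (penalty f u) G))"
  unfolding kappa_eq by (rule ennreal_infsum_eq_SUP) simp

lemma kappa_finite_iff: "kappa m \<phi> W f u < \<infinity> \<longleftrightarrow> penalty f u summable_on UNIV"
  unfolding kappa_eq by (rule ennreal_infsum_finite_iff) simp

text \<open>Midpoint convexity multiplied by two, which avoids division in
  \<open>ennreal\<close>.\<close>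

lemma kappa_midpoint:
  "kappa m \<phi> W f (\<lambda>x. 1/2 * (u x + v x)) + kappa m \<phi> W f (\<lambda>x. 1/2 * (u x + v x)) \<le>
   kappa m \<phi> W f u + kappa m \<phi> W f v"
  unfolding kappa_eq ennreal_infsum_add
proof (rule infsum_mono)
  fix x
  let ?h = "\<lambda>x. 1/2 * (u x + v x)"
  have eq: "f x - W x * ?h x = ((f x - W x * u x) + (f x - W x * v x)) / 2"
    by (simp add: field_simps)
  have "penalty f ?h x + penalty f ?h x \<le> penalty f u x + penalty f v x"
    unfolding penalty_def eq distrib_right[symmetric]
    by (intro mult_right_mono Phi_midpoint) (use m_pos[of x] W_pos[of x] in auto)
  then show "ennreal (penalty f ?h x) + ennreal (penalty f ?h x) \<le>
      ennreal (penalty f u x) + ennreal (penalty f v x)"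
    by (simp del: ennreal_plus add: ennreal_plus[symmetric] ennreal_leI)
qed (auto intro: nonneg_summable_on_complete)

text \<open>Upper bounds are tested on finite sums with independent index sets: \<open>F\<close>
  empty and \<open>G\<close> a singleton yields pointwise control, general finite sets yield lower
  semicontinuity.\<close>

lemma functional_le_iff:
  "functional m b \<phi> W f u \<le> c \<longleftrightarrow> (\<forall>F G. finite F \<longrightarrow> finite G \<longrightarrow>
     ennreal (1/2 * (\<Sum>(x, y)\<in>F. b x y * (u x - u y)\<^sup>2) + sum (penalty f u) G) \<le> c)"
proof -
  let ?e = "\<lambda>F. 1/2 * (\<Sum>(x, y)\<in>F. b x y * (u x - u y)\<^sup>2)" and ?k = "sum (penalty f u)"
  have e: "0 \<le> ?e F" for F by (auto intro!: sum_nonneg)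
  have k: "0 \<le> ?k G" for G by (auto intro!: sum_nonneg)
  have "functional m b \<phi> W f u =
      (SUP F\<in>{F. finite F}. ennreal (?e F) + (SUP G\<in>{G. finite G}. ennreal (?k G)))"
    unfolding functional_def energy_eq_SUP kappa_eq_SUP
    by (rule ennreal_SUP_add_left[symmetric]) auto
  also have "\<dots> = (SUP F\<in>{F. finite F}. SUP G\<in>{G. finite G}. ennreal (?e F) + ennreal (?k G))"
    by (subst ennreal_SUP_add_right) auto
  finally show ?thesis
    using e k by (simp add: SUP_le_iff)
qed

lemma functional_lower_semicontinuous:
  assumes lim: "\<And>x. (\<lambda>n. U n x) \<longlonglongrightarrow> u x"
    and le: "\<forall>\<^sub>F n in sequentially. functional m b \<phi> W f (U n) \<le> c"
  shows "functional m b \<phi> W f u \<le> c"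
  unfolding functional_le_iff
proof (intro allI impI)
  fix F :: "('a \<times> 'a) set" and G :: "'a set"
  assume fin: "finite F" "finite G"
  have cont: "isCont (Phi \<phi>) s" for s
    using Phi_has_real_derivative[OF phi_continuous] by (rule DERIV_isCont)
  have "(\<lambda>n. 1/2 * (\<Sum>(x, y)\<in>F. b x y * (U n x - U n y)\<^sup>2) + sum (penalty f (U n)) G) \<longlonglongrightarrow>
      1/2 * (\<Sum>(x, y)\<in>F. b x y * (u x - u y)\<^sup>2) + sum (penalty f u) G"
    unfolding penalty_def case_prod_unfold
    by (intro tendsto_intros lim isCont_tendsto_compose[OF cont])
  then show "ennreal (1/2 * (\<Sum>(x, y)\<in>F. b x y * (u x - u y)\<^sup>2) + sum (penalty f u) G) \<le> c"
    by (rule tendsto_upperbound[OF tendsto_ennrealI])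
       (use le in \<open>auto elim!: eventually_mono simp: functional_le_iff fin\<close>)
qed

section \<open>Existence of minimizers by the direct method\<close>

lemma functional_domain_iff:
  "u \<in> functional_domain m b \<phi> W f \<longleftrightarrow> u \<in> finite_energy0 b \<and> functional m b \<phi> W f u < \<infinity>"
  by (auto simp: functional_domain_def functional_def finite_energy0_def finite_energy_def)

lemma zero_functional_finite:
  assumes "f \<in> fin_supp"
  shows "(\<lambda>_. 0) \<in> functional_domain m b \<phi> W f"
proof -
  have "finite {x. penalty f (\<lambda>_. 0) x \<noteq> 0}"
    by (rule finite_subset[of _ "{x. f x \<noteq> 0}"])
       (use assms in \<open>auto simp: penalty_def fin_supp_def\<close>)
  then have "penalty f (\<lambda>_. 0) summable_on UNIV"
    using finite_nonzero_values_imp_summable_on[of UNIV "penalty f (\<lambda>_. 0)"] by simp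
  moreover have "(\<lambda>_. 0) \<in> finite_energy0 b"
    by (rule fin_supp_finite_energy0) (simp add: fin_supp_def)
  ultimately show ?thesis
    by (simp only: functional_domain_def mem_Collect_eq kappa_finite_iff)
qed

text \<open>The midpoint h is admissible, so its value is at least i. The parallelogram identity for
  the energy, together with mere convexity of \<kappa>, then leaves at most 2 (d + e) for the energy
  of u - v.\<close>

lemma almost_minimizers_close:
  assumes inf: "\<And>v. v \<in> functional_domain m b \<phi> W f \<Longrightarrow> ennreal i \<le> functional m b \<phi> W f v" and i: "0 \<le> i"
    and u: "u \<in> functional_domain m b \<phi> W f" "functional m b \<phi> W f u \<le> ennreal (i + d)"
    and v: "v \<in> functional_domain m b \<phi> W f" "functional m b \<phi> W f v \<le> ennreal (i + e)"
    and nonneg: "0 \<le> d" "0 \<le> e"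
  shows "energy b (\<lambda>x. u x - v x) \<le> ennreal (2 * (d + e))"
proof -
  define h where "h = (\<lambda>x. 1/2 * (u x + v x))"
  let ?E = "energy b" and ?K = "kappa m \<phi> W f"
  have K: "?K h + ?K h \<le> ?K u + ?K v"
    unfolding h_def by (rule kappa_midpoint)
  have "?K u + ?K v < \<infinity>" using u v by (simp add: functional_domain_def)
  with K have "?K h < \<infinity>"
    by (metis ennreal_add_eq_top infinity_ennreal_def le_less_trans less_top)
  moreover have "h \<in> finite_energy0 b"
    unfolding h_def using u v
    by (intro finite_energy0_scale finite_energy0_add) (auto simp: functional_domain_def)
  ultimately have h: "h \<in> functional_domain m b \<phi> W f"
    by (simp add: functional_domain_def)
  have sum_eq: "(\<lambda>x. u x + v x) = (\<lambda>x. 2 * h x)" by (simp add: h_def fun_eq_iff)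
  have par: "4 * ?E h + ?E (\<lambda>x. u x - v x) = 2 * ?E u + 2 * ?E v"
    using energy_parallelogram[of u v] unfolding sum_eq energy_scale
    by (simp add: mult_2)
  have "4 * ennreal i + ?E (\<lambda>x. u x - v x) \<le> 4 * (?E h + ?K h) + ?E (\<lambda>x. u x - v x)"
    using inf[OF h] by (intro add_right_mono mult_left_mono) (auto simp: functional_def)
  also have "\<dots> = (4 * ?E h + ?E (\<lambda>x. u x - v x)) + 2 * (?K h + ?K h)"
    by (simp add: distrib_left ac_simps mult_2[symmetric] mult.assoc[symmetric])
  also have "\<dots> \<le> (2 * ?E u + 2 * ?E v) + 2 * (?K u + ?K v)"
    unfolding par by (intro add_left_mono mult_left_mono K) auto
  also have "\<dots> = 2 * (?E u + ?K u) + 2 * (?E v + ?K v)"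
    by (simp add: distrib_left ac_simps)
  also have "\<dots> \<le> 2 * ennreal (i + d) + 2 * ennreal (i + e)"
    using u(2) v(2) by (intro add_mono mult_left_mono) (auto simp: functional_def)
  also have "\<dots> = 4 * ennreal i + ennreal (2 * (d + e))"
  proof -
    have "2 * ennreal t = ennreal (2 * t)" for t
      using ennreal_mult'[of 2 t] by simp
    then have "2 * ennreal (i + d) + 2 * ennreal (i + e) = ennreal (2 * (i + d)) + ennreal (2 * (i + e))"
      by (simp only:)
    also have "\<dots> = ennreal (2 * (i + d) + 2 * (i + e))"
      using i nonneg by (intro ennreal_plus[symmetric]) auto
    also have "\<dots> = ennreal (4 * i + 2 * (d + e))" by (simp add: algebra_simps)
    also have "\<dots> = ennreal (4 * i) + ennreal (2 * (d + e))"
      using i nonneg by (intro ennreal_plus) auto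
    finally show ?thesis using i by (simp add: ennreal_mult)
  qed
  finally show ?thesis
    by (subst (asm) ennreal_add_left_cancel_le) (auto simp: ennreal_mult_eq_top_iff)
qed

lemma minimizer_exists:
  assumes "f \<in> fin_supp"
  shows "\<exists>u. is_arg_min (functional m b \<phi> W f) (\<lambda>u. u \<in> functional_domain m b \<phi> W f) u"
proof -
  let ?J = "functional m b \<phi> W f" and ?D = "functional_domain m b \<phi> W f"
  define I where "I = (INF u\<in>?D. ?J u)"
  have "I \<le> ?J (\<lambda>_. 0)" unfolding I_def by (rule INF_lower) (rule zero_functional_finite[OF assms])
  also have "\<dots> < \<infinity>" using zero_functional_finite[OF assms] by (simp add: functional_domain_iff)
  finally obtain i where i: "I = ennreal i" "0 \<le> i" by (cases I) auto
  define e where "e n = 1 / real (Suc n)" for n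
  have e_pos: "0 < e n" for n by (simp add: e_def)
  have e_lim: "e \<longlonglongrightarrow> 0" unfolding e_def[abs_def] by (rule LIMSEQ_Suc[OF lim_1_over_n])
  have inf: "ennreal i \<le> ?J v" if "v \<in> ?D" for v
    using that unfolding i(1)[symmetric] I_def by (rule INF_lower)
  have "\<exists>u\<in>?D. ?J u < ennreal (i + e n)" for n
  proof -
    have "I < ennreal (i + e n)" using i e_pos[of n] by (simp add: ennreal_less_iff)
    then show ?thesis unfolding I_def by (simp add: INF_less_iff)
  qed
  then obtain U where U: "\<And>n. U n \<in> ?D" "\<And>n. ?J (U n) \<le> ennreal (i + e n)"
    by (metis less_imp_le)
  \<comment> \<open>No vertex contributes more than i + 1 to the functional, so \<Phi> at f x - W x
    * U n x is at most c. The coercivity bound for \<Phi>, solved for \<open>U n x\<close>, gives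
    this constant.\<close>
  define B where "B x = (let c = (i + 1) * (W x / m x) in
    (\<bar>f x\<bar> + (1 + c / (2 * \<phi> 1) + c / (- 2 * \<phi> (- 1)))) / W x)" for x
  have "\<bar>U n x\<bar> \<le> B x" for n x
  proof -
    have "ennreal (penalty f (U n) x) \<le> ?J (U n)"
      using functional_le_iff[of f "U n" "?J (U n)", THEN iffD1, rule_format, of "{}" "{x}"] by simp
    also have "\<dots> \<le> ennreal (i + e n)" by (rule U)
    finally have "penalty f (U n) x \<le> i + e n"
      using i e_pos[of n] by (subst (asm) ennreal_le_iff) auto
    also have "\<dots> \<le> i + 1" by (simp add: e_def)
    finally have "Phi \<phi> (f x - W x * U n x) \<le> (i + 1) * (W x / m x)"
      using m_pos[of x] W_pos[of x] by (simp add: penalty_def field_simps)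
    from Phi_sublevel_bounded[OF this]
    have "\<bar>W x * U n x\<bar> \<le> B x * W x"
      using W_pos[of x] unfolding B_def Let_def by simp
    then show ?thesis using W_pos[of x] by (simp add: abs_mult mult.commute)
  qed
  then obtain r u where r: "strict_mono (r :: nat \<Rightarrow> nat)" and lim: "\<And>x. (\<lambda>n. U (r n) x) \<longlonglongrightarrow> u x"
    using pointwise_bounded_convergent_subseq[of U B] by blast
  have r_ge: "n \<le> r n" for n using r by (rule seq_suble)
  have e_mono: "e k \<le> e n" if "n \<le> k" for n k using that by (simp add: e_def frac_le)
  \<comment> \<open>Fix n and let k tend to infinity in the Cauchy estimate: semicontinuity upgrades
    pointwise convergence to convergence in energy. The constant 4 comes from 2 (e (r k) + e (r n))
    with both terms at most e n.\<close>
  have close: "energy b (\<lambda>x. u x - U (r n) x) \<le> ennreal (4 * e n)" for n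
  proof (rule energy_lower_semicontinuous[where U = "\<lambda>k x. U (r k) x - U (r n) x"])
    show "(\<lambda>k. U (r k) x - U (r n) x) \<longlonglongrightarrow> u x - U (r n) x" for x
      by (intro tendsto_intros lim)
    show "\<forall>\<^sub>F k in sequentially. energy b (\<lambda>x. U (r k) x - U (r n) x) \<le> ennreal (4 * e n)"
    proof (rule eventually_sequentiallyI[of n])
      fix k assume "n \<le> k"
      then have "e (r k) \<le> e n" "e (r n) \<le> e n"
        using r_ge[of k] r_ge[of n] by (auto intro: e_mono)
      moreover have "energy b (\<lambda>x. U (r k) x - U (r n) x) \<le> ennreal (2 * (e (r k) + e (r n)))"
        using e_pos by (intro almost_minimizers_close[OF inf i(2) U U]) (auto intro: less_imp_le)
      ultimately show "energy b (\<lambda>x. U (r k) x - U (r n) x) \<le> ennreal (4 * e n)"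
        by (elim order_trans) (auto intro!: ennreal_leI)
    qed
  qed
  have u0: "u \<in> finite_energy0 b"
  proof (rule finite_energy0_closed[OF _ lim])
    show "U (r n) \<in> finite_energy0 b" for n using U(1) by (simp add: functional_domain_def)
    have "(\<lambda>n. ennreal (4 * e n)) \<longlonglongrightarrow> ennreal (4 * 0)"
      by (intro tendsto_ennrealI tendsto_mult tendsto_const e_lim)
    then show "(\<lambda>n. energy b (\<lambda>x. u x - U (r n) x)) \<longlonglongrightarrow> 0"
      using ennreal_tendsto_zero_le[OF close] by simp
  qed
  have Ju: "?J u \<le> ennreal i"
  proof (rule ennreal_le_epsilon)
    fix d :: real assume "0 < d"
    have "?J u \<le> ennreal (i + d)"
    proof (rule functional_lower_semicontinuous[OF lim])
      have "\<forall>\<^sub>F n in sequentially. e n < d" by (rule order_tendstoD(2)[OF e_lim \<open>0 < d\<close>])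
      then show "\<forall>\<^sub>F n in sequentially. ?J (U (r n)) \<le> ennreal (i + d)"
      proof eventually_elim
        case (elim n)
        then have "i + e (r n) \<le> i + d" using e_mono[OF r_ge[of n]] by simp
        then show ?case using U(2)[of "r n"] ennreal_leI order_trans by blast
      qed
    qed
    then show "?J u \<le> ennreal i + ennreal d" using i \<open>0 < d\<close> by simp
  qed
  have "u \<in> ?D" using u0 Ju by (auto simp: functional_domain_iff intro: le_less_trans)
  moreover have "\<not> ?J v < ?J u" if "v \<in> ?D" for v
    using order_trans[OF Ju inf[OF that]] by (simp add: not_less)
  ultimately show ?thesis by (auto simp: is_arg_min_def)
qed

section \<open>The Euler-Lagrange equation\<close>

lemma minimizer_equation:
  assumes "is_arg_min (functional m b \<phi> W f) (\<lambda>u. u \<in> functional_domain m b \<phi> W f) u"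
  shows "u \<in> finite_energy0 b" "laplacian m b u x = \<phi> (f x - W x * u x)"
proof -
  let ?J = "functional m b \<phi> W f" and ?D = "functional_domain m b \<phi> W f"
  have uD: "u \<in> ?D" and min: "\<And>v. v \<in> ?D \<Longrightarrow> ?J u \<le> ?J v"
    using assms by (auto simp: is_arg_min_def not_less)
  then show u0: "u \<in> finite_energy0 b" by (simp add: functional_domain_def)
  have pu: "penalty f u summable_on UNIV"
    using uD by (simp add: functional_domain_def kappa_finite_iff[symmetric])
  \<comment> \<open>Perturbing at the single vertex x changes only one term of \<kappa>, so no
    derivative has to be exchanged with an infinite sum.\<close>
  define w :: "'a \<Rightarrow> real" where "w y = (if y = x then 1 else 0)" for y
  have supp: "{y. w y \<noteq> 0} = {x}" by (auto simp: w_def)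
  have w: "w \<in> fin_supp" by (simp add: fin_supp_def supp)
  define q where "q = (\<Sum>\<^sub>\<infinity>(x, y). b x y * (w x - w y)\<^sup>2)"
  define Q where "Q = (\<Sum>\<^sub>\<infinity>(x, y). b x y * (u x - u y)\<^sup>2)"
  define L where "L = m x * laplacian m b u x"
  \<comment> \<open>The increment of the functional from u to u + t w, with the mixed energy term
    evaluated by Green's formula. Minimality of u makes 0 a minimum of \<open>H\<close>.\<close>
  define H where "H t = 2 * t * L + t\<^sup>2 * (q / 2) +
    (Phi \<phi> (f x - W x * (u x + t)) - Phi \<phi> (f x - W x * u x)) * (m x / W x)" for t
  have u_lap: "u \<in> lap_domain b" using u0 by (rule finite_energy0_lap_domain)
  have su: "(\<lambda>(x, y). b x y * (u x - u y)\<^sup>2) summable_on UNIV"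
    using finite_energy0_finite_energy[OF u0] by (simp add: finite_energy_iff)
  have sw: "(\<lambda>(x, y). b x y * (w x - w y)\<^sup>2) summable_on UNIV"
    using fin_supp_finite_energy[OF w] by (simp add: finite_energy_iff)
  have suw: "(\<lambda>(x, y). b x y * ((u x - u y) * (w x - w y))) summable_on UNIV"
    by (rule green_summable[OF u_lap w])
  have green_uw: "(\<Sum>\<^sub>\<infinity>(x, y). b x y * ((u x - u y) * (w x - w y))) = 2 * L"
    using green[OF u_lap w] by (simp add: supp L_def w_def)
  have Hnonneg: "0 \<le> H t" for t
  proof -
    define v where "v y = u y + t * w y" for y
    have v0: "v \<in> finite_energy0 b"
      unfolding v_def[abs_def] by (intro finite_energy0_add u0 fin_supp_finite_energy0 fin_supp_scale w)
    have split: "(\<lambda>(x, y). b x y * (v x - v y)\<^sup>2) = (\<lambda>p. (\<lambda>(x, y). b x y * (u x - u y)\<^sup>2) p +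
        (2 * t * (\<lambda>(x, y). b x y * ((u x - u y) * (w x - w y))) p +
         t\<^sup>2 * (\<lambda>(x, y). b x y * (w x - w y)\<^sup>2) p))"
      by (auto simp: fun_eq_iff v_def power2_eq_square algebra_simps)
    have Qv: "(\<Sum>\<^sub>\<infinity>(x, y). b x y * (v x - v y)\<^sup>2) = Q + (2 * t * (2 * L) + t\<^sup>2 * q)"
      unfolding split Q_def q_def green_uw[symmetric]
      by (simp only: infsum_add infsum_cmult_right' summable_on_add summable_on_cmult_right su sw suw)
    define c where "c = penalty f v x - penalty f u x"
    have pv_eq: "penalty f v = (\<lambda>y. penalty f u y + (if y = x then c else 0))"
      by (auto simp: fun_eq_iff penalty_def c_def v_def w_def)
    have sc: "(\<lambda>y. if y = x then c else 0) summable_on UNIV"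
      by (rule finite_nonzero_values_imp_summable_on) (auto intro: finite_subset[of _ "{x}"])
    have ic: "(\<Sum>\<^sub>\<infinity>y. if y = x then c else 0) = c"
      using infsum_cong_neutral[of "{x}" UNIV "\<lambda>y. if y = x then c else 0" "\<lambda>y. if y = x then c else 0"]
      by simp
    have pv: "penalty f v summable_on UNIV" unfolding pv_eq by (rule summable_on_add[OF pu sc])
    have Kv: "infsum (penalty f v) UNIV = infsum (penalty f u) UNIV + c"
      unfolding pv_eq infsum_add[OF pu sc] ic ..
    have "v \<in> ?D" using v0 pv by (simp add: functional_domain_def kappa_finite_iff[symmetric])
    from min[OF this] have le: "?J u \<le> ?J v" .
    have J: "?J h = ennreal (1/2 * (\<Sum>\<^sub>\<infinity>(x, y). b x y * (h x - h y)\<^sup>2) + infsum (penalty f h) UNIV)"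
      if "h \<in> finite_energy0 b" "penalty f h summable_on UNIV" for h
    proof -
      have "kappa m \<phi> W f h = ennreal (infsum (penalty f h) UNIV)"
        unfolding kappa_eq using that by (intro ennreal_infsum_summable) auto
      then show ?thesis
        unfolding functional_def energy_eq_infsum[OF finite_energy0_finite_energy[OF that(1)]]
        by (simp only:) (intro ennreal_plus[symmetric], auto intro!: infsum_nonneg)
    qed
    have "0 \<le> 1/2 * (\<Sum>\<^sub>\<infinity>(x, y). b x y * (v x - v y)\<^sup>2) + infsum (penalty f v) UNIV"
      by (auto intro!: infsum_nonneg add_nonneg_nonneg)
    with le have "1/2 * Q + infsum (penalty f u) UNIV \<le>
        1/2 * (Q + (2 * t * (2 * L) + t\<^sup>2 * q)) + (infsum (penalty f u) UNIV + c)"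
      unfolding J[OF u0 pu] J[OF v0 pv] Qv Kv Q_def[symmetric] by (simp only: ennreal_le_iff)
    moreover have "1/2 * (Q + (2 * t * (2 * L) + t\<^sup>2 * q)) = 1/2 * Q + (2 * t * L + t\<^sup>2 * (q / 2))"
      by (simp add: algebra_simps add_divide_distrib)
    moreover have "c = (Phi \<phi> (f x - W x * (u x + t)) - Phi \<phi> (f x - W x * u x)) * (m x / W x)"
      by (simp add: c_def penalty_def v_def w_def left_diff_distrib diff_divide_distrib)
    ultimately show ?thesis unfolding H_def by linarith
  qed
  have "(H has_real_derivative 2 * L + (2 * \<phi> (f x - W x * u x)) * (- W x) * (m x / W x)) (at 0)"
  proof -
    have "((\<lambda>t. Phi \<phi> (f x - W x * (u x + t))) has_real_derivative
        (2 * \<phi> (f x - W x * (u x + 0))) * (- W x)) (at 0)"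
      by (rule DERIV_chain2[OF Phi_has_real_derivative[OF phi_continuous]])
         (auto intro!: derivative_eq_intros)
    then show ?thesis
      unfolding H_def[abs_def] by (auto intro!: derivative_eq_intros)
  qed
  moreover have "H 0 = 0" by (simp add: H_def)
  ultimately have "2 * L + (2 * \<phi> (f x - W x * u x)) * (- W x) * (m x / W x) = 0"
    using Hnonneg by (intro DERIV_local_min[of H _ 0 1]) auto
  \<comment> \<open>The weight m / W in \<kappa> cancels the inner derivative -W.\<close>
  then have "m x * laplacian m b u x = m x * \<phi> (f x - W x * u x)"
    using W_pos[of x] by (simp add: L_def)
  then show "laplacian m b u x = \<phi> (f x - W x * u x)" using m_pos[of x] by simp
qed

section \<open>Comparison of solutions and properties of the resolvent\<close>

lemma solution_nonneg:
  assumes u: "u \<in> finite_energy0 b" and eq: "\<And>x. laplacian m b u x = \<phi> (f x - W x * u x)"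
    and f: "\<And>x. 0 \<le> f x"
  shows "0 \<le> u x"
proof -
  have lap0: "(\<lambda>_. 0) \<in> lap_domain b" by (simp add: lap_domain_def)
  have neg: "(\<lambda>x. - u x) \<in> finite_energy0 b"
    using finite_energy0_scale[OF u, of "- 1"] by simp
  have "- u x \<le> 0" for x
  proof (rule comparison_principle[OF neg lap0])
    \<comment> \<open>Where u is negative, f - W u is positive, hence so is the Laplacian of u; this
      is the hypothesis for comparing -u with 0.\<close>
    fix x assume "0 < - u x"
    then have "0 < f x - W x * u x"
      using f[of x] W_pos[of x] by (smt (verit) mult_pos_neg)
    then have "0 < laplacian m b u x" using phi_less_iff[of 0] by (simp add: eq phi_0)
    moreover have "laplacian m b (\<lambda>x. - u x) x = - laplacian m b u x"
      using laplacian_diff[OF lap0 finite_energy0_lap_domain[OF u]] by (simp add: laplacian_def)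
    ultimately show "laplacian m b (\<lambda>x. - u x) x < laplacian m b (\<lambda>_. 0) x"
      by (simp add: laplacian_def)
  qed simp
  then show ?thesis by simp
qed

text \<open>Where u exceeds g, strict monotonicity of \<phi> turns f - W u < f - W g into a strict
  inequality of Laplacians. Undoing \<open>inv \<phi>\<close> uses that the Laplacian of g takes
  values in the range of \<phi>, which need not be all reals.\<close>

lemma solution_le_supersolution:
  assumes u: "u \<in> finite_energy0 b" and eq: "\<And>x. laplacian m b u x = \<phi> (f x - W x * u x)"
    and g: "g \<in> lap_domain_phi m b \<phi>" "\<And>x. 0 \<le> g x"
    and super: "\<And>x. f x \<le> inv \<phi> (laplacian m b g x) + W x * g x"
  shows "u x \<le> g x"
proof (rule comparison_principle[OF u _ g(2)])
  show "g \<in> lap_domain b" using g(1) by (simp add: lap_domain_phi_def)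
  fix x assume "g x < u x"
  then have "f x - W x * u x < f x - W x * g x" using W_pos[of x] by simp
  then have "\<phi> (f x - W x * u x) < \<phi> (f x - W x * g x)" by (simp add: phi_less_iff)
  also have "\<dots> \<le> \<phi> (inv \<phi> (laplacian m b g x))"
    using super[of x] by (simp add: phi_le_iff)
  also have "\<dots> = laplacian m b g x"
    using g(1) by (intro f_inv_into_f) (auto simp: lap_domain_phi_def)
  finally show "laplacian m b u x < laplacian m b g x" by (simp add: eq)
qed

lemma solution_lap_domain_phi:
  assumes "u \<in> finite_energy0 b" and "\<And>x. laplacian m b u x = \<phi> (f x - W x * u x)"
  shows "u \<in> lap_domain_phi m b \<phi>"
  using assms finite_energy0_lap_domain by (auto simp: lap_domain_phi_def)

text \<open>Every minimizer is a nonnegative solution, hence a supersolution for every other one, so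
  two minimizers dominate each other. Uniqueness therefore comes from comparison and makes the
  definite description in \<open>resolvent\<close> denote the minimizer.\<close>

lemma
  assumes f: "f \<in> fin_supp" "\<And>x. 0 \<le> f x"
  shows resolvent_finite_energy0: "resolvent m b \<phi> W f \<in> finite_energy0 b"
    and laplacian_resolvent:
      "laplacian m b (resolvent m b \<phi> W f) x = \<phi> (f x - W x * resolvent m b \<phi> W f x)"
proof -
  let ?min = "is_arg_min (functional m b \<phi> W f) (\<lambda>u. u \<in> functional_domain m b \<phi> W f)"
  have le: "u x \<le> v x" if "?min u" "?min v" for u v x
    by (rule solution_le_supersolution[of u f v])
       (simp_all add: minimizer_equation[OF that(1)] minimizer_equation(2)[OF that(2)] inv_phi
         solution_lap_domain_phi[of v f, OF minimizer_equation[OF that(2)]]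
         solution_nonneg[of v f, OF minimizer_equation[OF that(2)] f(2)])
  obtain u where u: "?min u" using minimizer_exists[OF f(1)] by blast
  have "?min (resolvent m b \<phi> W f)"
    unfolding resolvent_def by (rule theI[of ?min, OF u]) (auto intro!: ext antisym le u)
  from minimizer_equation[OF this] show "resolvent m b \<phi> W f \<in> finite_energy0 b"
    "laplacian m b (resolvent m b \<phi> W f) x = \<phi> (f x - W x * resolvent m b \<phi> W f x)" by blast+
qed

lemma resolvent_nonneg:
  assumes "f \<in> fin_supp" "\<And>x. 0 \<le> f x"
  shows "0 \<le> resolvent m b \<phi> W f x"
  using solution_nonneg[OF resolvent_finite_energy0 laplacian_resolvent] assms by blast

lemma resolvent_le_supersolution:
  assumes f: "f \<in> fin_supp" "\<And>x. 0 \<le> f x"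
    and g: "g \<in> lap_domain_phi m b \<phi>" "\<And>x. 0 \<le> g x"
      "\<And>x. f x \<le> inv \<phi> (laplacian m b g x) + W x * g x"
  shows "resolvent m b \<phi> W f x \<le> g x"
  by (rule solution_le_supersolution[OF resolvent_finite_energy0[OF f] laplacian_resolvent[OF f] g])

text \<open>The resolvent of the larger h solves its own equation and is thus a supersolution for
  f.\<close>

lemma resolvent_mono:
  assumes "f \<in> fin_supp" "\<And>x. 0 \<le> f x" "h \<in> fin_supp" "\<And>x. f x \<le> h x"
  shows "resolvent m b \<phi> W f x \<le> resolvent m b \<phi> W h x"
proof -
  have h: "\<And>x. 0 \<le> h x" using assms(2,4) order_trans by blast
  show ?thesis
    by (rule resolvent_le_supersolution[OF assms(1,2)
          solution_lap_domain_phi[OF resolvent_finite_energy0 laplacian_resolvent]])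
       (use assms h in \<open>simp_all add: resolvent_nonneg laplacian_resolvent inv_phi\<close>)
qed

section \<open>The extended resolvent\<close>

lemma ext_resolvent_le_supersolution:
  assumes g: "g \<in> lap_domain_phi m b \<phi>" "\<And>x. 0 \<le> g x"
      "\<And>x. f x \<le> inv \<phi> (laplacian m b g x) + W x * g x"
  shows "ext_resolvent m b \<phi> W f x \<le> ereal (g x)"
  unfolding ext_resolvent_def
proof (rule SUP_least)
  fix h assume "h \<in> {h \<in> fin_supp. \<forall>y. 0 \<le> h y \<and> h y \<le> f y}"
  then have h: "h \<in> fin_supp" "\<And>y. 0 \<le> h y" "\<And>y. h y \<le> f y" by auto
  show "ereal (resolvent m b \<phi> W h x) \<le> ereal (g x)"
    using resolvent_le_supersolution[OF h(1,2) g(1,2) order_trans[OF h(3) g(3)]] by simp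
qed

text \<open>The zero function competes in the supremum. With finiteness this rules out both
  infinities, so \<open>real_of_ereal\<close> loses nothing.\<close>

lemma ext_resolvent_nonneg:
  assumes "\<And>x. 0 \<le> f x"
  shows "0 \<le> ext_resolvent m b \<phi> W f x"
proof -
  have "(\<lambda>_. 0) \<in> fin_supp" by (simp add: fin_supp_def)
  then have "ereal (resolvent m b \<phi> W (\<lambda>_. 0) x) \<le> ext_resolvent m b \<phi> W f x"
    unfolding ext_resolvent_def by (intro SUP_upper) (simp add: assms)
  moreover have "0 \<le> ereal (resolvent m b \<phi> W (\<lambda>_. 0) x)"
    by (simp add: resolvent_nonneg fin_supp_def)
  ultimately show ?thesis by (rule order_trans[rotated])
qed

lemma ext_resolvent_solution:
  assumes f: "\<And>x. 0 \<le> f x" and finite: "\<And>x. ext_resolvent m b \<phi> W f x < \<infinity>"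
  defines "u \<equiv> \<lambda>x. real_of_ereal (ext_resolvent m b \<phi> W f x)"
  shows "u \<in> lap_domain b" "laplacian m b u x = \<phi> (f x - W x * u x)"
proof -
  have u_eq: "ereal (u x) = ext_resolvent m b \<phi> W f x" for x
    using finite[of x] ext_resolvent_nonneg[of f x, OF f]
    by (cases "ext_resolvent m b \<phi> W f x") (auto simp: u_def)
  \<comment> \<open>Truncations of f along the enumeration of X; each vertex is included from some
    stage on.\<close>
  define g where "g n x = (if to_nat x < n then f x else 0)" for n :: nat and x
  have g: "g n \<in> fin_supp" "\<And>x. 0 \<le> g n x" "\<And>x. g n x \<le> f x" for n
  proof -
    have "finite {x::'a. to_nat x < n}"
      using finite_vimageI[of "{..<n}" "to_nat :: 'a \<Rightarrow> nat"] by (simp add: vimage_def)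
    then show "g n \<in> fin_supp"
      by (auto simp: fin_supp_def g_def elim!: rev_finite_subset split: if_splits)
  qed (auto simp: g_def f)
  define U where "U n = resolvent m b \<phi> W (g n)" for n
  have U0: "0 \<le> U n x" for n x unfolding U_def by (intro resolvent_nonneg g)
  have Ule: "U n x \<le> u x" for n x
  proof -
    have "ereal (U n x) \<le> ereal (u x)"
      unfolding u_eq U_def ext_resolvent_def by (rule SUP_upper) (use g in auto)
    then show ?thesis by simp
  qed
  have lim: "(\<lambda>n. U n x) \<longlonglongrightarrow> u x" for x
  proof (rule order_tendstoI)
    fix a assume "a < u x"
    then have "ereal a < ext_resolvent m b \<phi> W f x" by (simp flip: u_eq)
    then obtain h where h: "h \<in> fin_supp" "\<And>y. 0 \<le> h y" "\<And>y. h y \<le> f y"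
      and a: "a < resolvent m b \<phi> W h x"
      unfolding ext_resolvent_def less_SUP_iff by auto
    \<comment> \<open>From stage N on, the truncations of f dominate the competitor h, so resolvents
      along one sequence reach the supremum. If h = 0, \<open>Max\<close> is taken of the empty set,
      but the next claim is then vacuous.\<close>
    define N where "N = Suc (Max (to_nat ` {y. h y \<noteq> 0}))"
    have N: "to_nat y < N" if "h y \<noteq> 0" for y
      using h(1) that unfolding N_def fin_supp_def by (auto intro!: le_imp_less_Suc Max_ge)
    show "\<forall>\<^sub>F n in sequentially. a < U n x"
    proof (rule eventually_sequentiallyI[of N])
      fix n assume n: "N \<le> n"
      have "h y \<le> g n y" for y
        using N[of y] n h(3)[of y] by (cases "h y = 0") (auto simp: g_def f)
      then show "a < U n x"
        using a resolvent_mono[OF h(1,2) g(1)] unfolding U_def by (meson less_le_trans)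
    qed
  next
    fix a assume "u x < a"
    then show "\<forall>\<^sub>F n in sequentially. U n x < a"
      using Ule le_less_trans by (intro always_eventually allI) blast
  qed
  have ULap: "U n \<in> lap_domain b" for n
    unfolding U_def by (intro finite_energy0_lap_domain resolvent_finite_energy0 g)
  have Ueq: "laplacian m b (U n) x = \<phi> (g n x - W x * U n x)" for n x
    unfolding U_def by (intro laplacian_resolvent g)
  have cont: "isCont \<phi> s" for s
    using phi_continuous by (simp add: continuous_on_eq_continuous_at)
  \<comment> \<open>The limit of the equations for \<open>U n\<close>, solved for the neighbour sum.
    Its existence is what proves that this sum is finite for u; only afterwards is the Laplacian of
    u meaningful.\<close>
  define s where "s x = infsum (b x) UNIV * u x - m x * \<phi> (f x - W x * u x)" for x
  have "((\<lambda>y. b x y * u y) has_sum s x) UNIV" for x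
  proof (rule has_sum_monotone_limit[where f = "\<lambda>n y. b x y * U n y"])
    show "(\<lambda>n. \<Sum>\<^sub>\<infinity>y. b x y * U n y) \<longlonglongrightarrow> s x"
    proof -
      have "(\<Sum>\<^sub>\<infinity>y. b x y * U n y) = infsum (b x) UNIV * U n x - m x * \<phi> (g n x - W x * U n x)" for n
        using m_laplacian_eq_diff[OF ULap[of n], of x] by (simp add: Ueq)
      moreover have "(\<lambda>n. g n x) \<longlonglongrightarrow> f x"
        by (rule tendsto_eventually, rule eventually_sequentiallyI[of "Suc (to_nat x)"]) (simp add: g_def)
      ultimately show ?thesis
        unfolding s_def by (auto intro!: tendsto_intros lim isCont_tendsto_compose[OF cont])
    qed
  qed (auto intro!: mult_left_mono Ule tendsto_mult_left lim laplacian_row_summable ULap simp: U0)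
  then have sum: "(\<lambda>y. b x y * u y) summable_on UNIV" "(\<Sum>\<^sub>\<infinity>y. b x y * u y) = s x" for x
    by (auto simp: summable_on_def infsumI)
  have "0 \<le> u x" for x using U0 Ule order_trans by blast
  then show u: "u \<in> lap_domain b" using sum(1) by (simp add: lap_domain_def)
  have "m x * laplacian m b u x = m x * \<phi> (f x - W x * u x)"
    unfolding m_laplacian_eq_diff[OF u] sum(2) s_def by simp
  then show "laplacian m b u x = \<phi> (f x - W x * u x)" using m_pos[of x] by simp
qed

end

theorem theorem3p14:
  fixes m W f :: "'a::countable \<Rightarrow> real"
    and b :: "'a \<Rightarrow> 'a \<Rightarrow> real"
    and \<phi> :: "real \<Rightarrow> real"
  assumes "\<And>x. m x > 0"
    and "weighted_graph b"
    and "continuous_on UNIV \<phi>" and "strict_mono \<phi>" and "\<phi> 0 = 0"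
    and "\<And>x. W x > 0" and "(INF x. W x) > 0"
    and "\<And>x. f x \<ge> 0"
  shows "((\<forall>x. ext_resolvent m b \<phi> W f x < \<infinity>) \<longrightarrow>
           (let u = (\<lambda>x. real_of_ereal (ext_resolvent m b \<phi> W f x)) in
             u \<in> lap_domain_phi m b \<phi> \<and>
             (\<forall>x. inv \<phi> (laplacian m b u x) + W x * u x = f x))) \<and>
         ((\<forall>x. ext_resolvent m b \<phi> W f x < \<infinity>) \<longleftrightarrow>
           (\<exists>g \<in> lap_domain_phi m b \<phi>. (\<forall>x. g x \<ge> 0) \<and>
             (\<forall>x. inv \<phi> (laplacian m b g x) + W x * g x \<ge> f x))) \<and>
         (\<forall>g \<in> lap_domain_phi m b \<phi>. (\<forall>x. g x \<ge> 0) \<and>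
             (\<forall>x. inv \<phi> (laplacian m b g x) + W x * g x \<ge> f x) \<longrightarrow>
           (\<forall>x. ereal (g x) \<ge> ext_resolvent m b \<phi> W f x))"
proof -
  interpret resolvent_problem m b \<phi> W
    by unfold_locales (rule assms)+
  let ?u = "\<lambda>x. real_of_ereal (ext_resolvent m b \<phi> W f x)"
  have a: "?u \<in> lap_domain_phi m b \<phi>" "inv \<phi> (laplacian m b ?u x) + W x * ?u x = f x"
    if "\<forall>x. ext_resolvent m b \<phi> W f x < \<infinity>" for x
  proof -
    note sol = ext_resolvent_solution[of f, OF assms(8) that[rule_format]]
    show "?u \<in> lap_domain_phi m b \<phi>" using sol by (auto simp: lap_domain_phi_def)
    show "inv \<phi> (laplacian m b ?u x) + W x * ?u x = f x" by (simp add: sol(2) inv_phi)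
  qed
  have c: "ext_resolvent m b \<phi> W f x \<le> ereal (g x)"
    if "g \<in> lap_domain_phi m b \<phi>" "\<forall>x. g x \<ge> 0"
      "\<forall>x. inv \<phi> (laplacian m b g x) + W x * g x \<ge> f x" for g x
    using that by (intro ext_resolvent_le_supersolution) auto
  have nonneg: "0 \<le> ?u x" for x
    by (intro real_of_ereal_pos ext_resolvent_nonneg assms(8))
  \<comment> \<open>Domination by a real-valued supersolution gives the backward direction of
    (b).\<close>
  have fin: "ext_resolvent m b \<phi> W f x < \<infinity>" if "ext_resolvent m b \<phi> W f x \<le> ereal r" for x r
    using that by (rule le_less_trans) simp
  show ?thesis
    unfolding Let_def
  proof (intro conjI impI iffI ballI allI)
    assume fin: "\<forall>x. ext_resolvent m b \<phi> W f x < \<infinity>"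
    \<comment> \<open>The extended resolvent itself is the witness, since by (a) it satisfies the
      equation with equality.\<close>
    show "\<exists>g\<in>lap_domain_phi m b \<phi>. (\<forall>x. g x \<ge> 0) \<and>
        (\<forall>x. inv \<phi> (laplacian m b g x) + W x * g x \<ge> f x)"
      by (rule bexI[of _ ?u]) (simp_all only: a[OF fin] nonneg order_refl simp_thms)
  qed (use a c fin in blast)+
qed

end
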